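(* Let $\mathfrak A=\bigoplus_{r\in R}\mathfrak A_r$ and $\mathfrak B=\bigoplus_{x\in X}\mathfrak B_x$ be $G$-algebras with fixed decompositions into irreducible $G$-submodules and fixed $G$-isomorphisms $\bar\tau^{\mathfrak A}_r:V_{\epsilon(r)}\to\mathfrak A_r$, $\bar\tau^{\mathfrak B}_x:V_{\epsilon(x)}\to\mathfrak B_x$. Let $\varphi:\mathfrak A\to\mathfrak B$ be a $G$-module morphism (with $G$-matrix $f_{x,r}$), and let $P(\varphi):P(\mathfrak A)\to P(\mathfrak B)$ be the associated linear map. Then $\varphi$ is a $G$-algebra morphism if and only if $P(\varphi):P(\mathfrak A,Q)\to P(\mathfrak B,Q)$ is an algebra homomorphism for every choice $Q$ in the labeling of $\mathrm{Rep}(G)$.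
   Context: $\mathbb K$ is a field of characteristic zero and $G$ is a group such that every finite dimensional representation of $G$ over $\mathbb K$ is completely reducible; $\mathrm{Rep}(G)$ is the category of finite dimensional representations of $G$ over $\mathbb K$. Algebras are not necessarily associative. A $G$-algebra is a $\mathbb K$-algebra $\mathfrak A$ on which $G$ acts by algebra automorphisms so that $\mathfrak A$ is a direct sum of finite dimensional irreducible $G$-submodules. A $G$-algebra morphism is an algebra homomorphism that is also a $G$-module morphism. Labeling of $\mathrm{Rep}(G)$: a choice of a set $\{V_i: i\in\hat I\}$ of representatives of the isomorphism classes of irreducible representations in $\mathrm{Rep}(G)$ (one for each class), and, for all $i_1,i_2,j\in\hat I$, of a basis $\{m_q^{i_1,i_2,j}: q=1,\dots,d^{i_1,i_2,j}\}$ of $\mathrm{Hom}_G(V_{i_1}\otimes V_{i_2},V_j)$, where $d^{i_1,i_2,j}=\dim \mathrm{Hom}_G(V_{i_1}\otimes V_{i_2},V_j)$. A labeling is fixed. Given a $G$-algebra $\mathfrak A$ with product $\mu$, a decomposition $\mathfrak A=\bigoplus_{r\in R}\mathfrak A_r$ into irreducible $G$-submodules, and $G$-isomorphisms $\bar\tau_r:V_{\epsilon(r)}\to\mathfrak A_r$ ($\epsilon(r)\in\hat I$), the $G$-table of $\mathfrak A$ is the uniquely determined set of scalars $c_{r_1,r_2}^{s,q}\in\mathbb K$ such that for all $r_1,r_2\in R$ $$\mu|_{\mathfrak A_{r_1}\otimes\mathfrak A_{r_2}}=\sum_{s\in R}\ \sum_{q=1}^{d^{\epsilon(r_1),\epsilon(r_2),\epsilon(s)}}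 c_{r_1,r_2}^{s,q}\ \bar\tau_s\circ m_q^{\epsilon(r_1),\epsilon(r_2),\epsilon(s)}\circ(\bar\tau_{r_1}\otimes\bar\tau_{r_2})^{-1}.$$ A choice $Q$ in the labeling is a map assigning to each triple $(i_1,i_2,j)\in\hat I^3$ with $d^{i_1,i_2,j}\ge1$ an integer $Q(i_1,i_2,j)\in\{1,\dots,d^{i_1,i_2,j}\}$. $P(\mathfrak A)$ is the $\mathbb K$-vector space with basis $\{e^{\mathfrak A}_r:r\in R\}$, and $P(\mathfrak A,Q)$ is $P(\mathfrak A)$ with the (not necessarily associative) product $$e^{\mathfrak A}_{r_1}\cdot e^{\mathfrak A}_{r_2}=\sum_{s\in R}c_{r_1,r_2}^{s,Q(\epsilon(r_1),\epsilon(r_2),\epsilon(s))}\,e^{\mathfrak A}_s,$$ where terms with $d^{\epsilon(r_1),\epsilon(r_2),\epsilon(s)}=0$ are omitted. Similarly for $\mathfrak B$, with basis $\{e^{\mathfrak B}_x:x\in X\}$. The $G$-matrix of a $G$-module morphism $\varphi:\mathfrak A\to\mathfrak B$ is the set of scalars $f_{x,r}\in\mathbb K$, for $r\in R$ and $x\in X_r=\{y\in X:\epsilon(y)=\epsilon(r)\}$, with $\varphi|_{\mathfrak A_r}=\sum_{x\in X_r}f_{x,r}\,\bar\tau^{\mathfrak B}_x\circ(\bar\tau^{\mathfrak A}_r)^{-1}$ (for each $r$ only finitely many are nonzero). Set $f_{x,r}=0$ if $x\notin X_r$. Then $P(\varphi):P(\mathfrak A)\to P(\mathfrak B)$ is the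 linear map $e^{\mathfrak A}_r\mapsto\sum_{x\in X}f_{x,r}\,e^{\mathfrak B}_x$. *)

theory Defs
  imports Complex_Main "HOL-Algebra.Group" "HOL-Library.Function_Algebras" "HOL-Library.Poly_Mapping"
begin

section \<open>Representations and their morphisms\<close>

text \<open>
  A vector space is a subspace (the carrier) of a vector space structure on a whole type, so that
  the notions of \<^theory>\<open>HOL.Vector_Spaces\<close> apply and submodules live in the type of the module.
\<close>

record ('k, 'v) vect = "'v partial_object" +
  scl :: "'k \<Rightarrow> 'v \<Rightarrow> 'v"

record ('g, 'k, 'v) rep = "('k, 'v) vect" +
  act :: "'g \<Rightarrow> 'v \<Rightarrow> 'v"

definition is_vect :: "('k::field, 'v::ab_group_add, 'y) vect_scheme \<Rightarrow> bool" where
  "is_vect M \<longleftrightarrow> vector_space (scl M) \<and> module.subspace (scl M) (carrier M)"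

definition fin_dim :: "('k::field, 'v::ab_group_add, 'y) vect_scheme \<Rightarrow> bool" where
  "fin_dim M \<longleftrightarrow> (\<exists>B. finite B \<and> module.span (scl M) B = carrier M)"

definition linear_map ::
  "('k::field, 'v::ab_group_add, 'y) vect_scheme \<Rightarrow> ('k, 'w::ab_group_add, 'z) vect_scheme
    \<Rightarrow> ('v \<Rightarrow> 'w) \<Rightarrow> bool" where
  "linear_map M N f \<longleftrightarrow>
     (\<forall>x\<in>carrier M. f x \<in> carrier N) \<and>
     (\<forall>x\<in>carrier M. \<forall>y\<in>carrier M. f (x + y) = f x + f y) \<and>
     (\<forall>a. \<forall>x\<in>carrier M. f (scl M a x) = scl N a (f x))"

definition bilinear_map ::
  "('k::field, 'u::ab_group_add, 'x) vect_scheme \<Rightarrow> ('k, 'v::ab_group_add, 'y) vect_scheme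
    \<Rightarrow> ('k, 'w::ab_group_add, 'z) vect_scheme \<Rightarrow> ('u \<Rightarrow> 'v \<Rightarrow> 'w) \<Rightarrow> bool" where
  "bilinear_map M N P b \<longleftrightarrow>
     (\<forall>x\<in>carrier M. linear_map N P (b x)) \<and> (\<forall>y\<in>carrier N. linear_map M P (\<lambda>x. b x y))"

definition is_rep ::
  "('g, 'm) monoid_scheme \<Rightarrow> ('g, 'k::field, 'v::ab_group_add) rep \<Rightarrow> bool" where
  "is_rep G M \<longleftrightarrow>
     is_vect M \<and>
     (\<forall>g\<in>carrier G. linear_map M M (act M g)) \<and>
     (\<forall>x\<in>carrier M. act M \<one>\<^bsub>G\<^esub> x = x) \<and>
     (\<forall>g\<in>carrier G. \<forall>h\<in>carrier G. \<forall>x\<in>carrier M. act M (g \<otimes>\<^bsub>G\<^esub> h) x = act M g (act M h x))"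

definition is_submodule ::
  "('g, 'm) monoid_scheme \<Rightarrow> ('g, 'k::field, 'v::ab_group_add) rep \<Rightarrow> 'v set \<Rightarrow> bool" where
  "is_submodule G M S \<longleftrightarrow>
     S \<subseteq> carrier M \<and> module.subspace (scl M) S \<and> (\<forall>g\<in>carrier G. \<forall>x\<in>S. act M g x \<in> S)"

definition sub_rep :: "('g, 'k, 'v) rep \<Rightarrow> 'v set \<Rightarrow> ('g, 'k, 'v) rep" where
  "sub_rep M S = M\<lparr>carrier := S\<rparr>"

definition is_irreducible ::
  "('g, 'm) monoid_scheme \<Rightarrow> ('g, 'k::field, 'v::ab_group_add) rep \<Rightarrow> bool" where
  "is_irreducible G M \<longleftrightarrow>
     is_rep G M \<and> carrier M \<noteq> {0} \<and> (\<forall>S. is_submodule G M S \<longrightarrow> S = {0} \<or> S = carrier M)"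

definition G_morphism ::
  "('g, 'm) monoid_scheme \<Rightarrow> ('g, 'k::field, 'v::ab_group_add) rep
    \<Rightarrow> ('g, 'k, 'w::ab_group_add) rep \<Rightarrow> ('v \<Rightarrow> 'w) \<Rightarrow> bool" where
  "G_morphism G M N f \<longleftrightarrow>
     linear_map M N f \<and> (\<forall>g\<in>carrier G. \<forall>x\<in>carrier M. f (act M g x) = act N g (f x))"

definition G_isomorphism ::
  "('g, 'm) monoid_scheme \<Rightarrow> ('g, 'k::field, 'v::ab_group_add) rep
    \<Rightarrow> ('g, 'k, 'w::ab_group_add) rep \<Rightarrow> ('v \<Rightarrow> 'w) \<Rightarrow> bool" where
  "G_isomorphism G M N f \<longleftrightarrow> G_morphism G M N f \<and> bij_betw f (carrier M) (carrier N)"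

definition isomorphic_reps ::
  "('g, 'm) monoid_scheme \<Rightarrow> ('g, 'k::field, 'v::ab_group_add) rep
    \<Rightarrow> ('g, 'k, 'w::ab_group_add) rep \<Rightarrow> bool" where
  "isomorphic_reps G M N \<longleftrightarrow> (\<exists>f. G_isomorphism G M N f)"

text \<open>Morphisms are normalised to vanish off the carrier, so that \<open>Hom\<^sub>G\<close> is a vector space.\<close>

definition Hom_G ::
  "('g, 'm) monoid_scheme \<Rightarrow> ('g, 'k::field, 'v::ab_group_add) rep
    \<Rightarrow> ('g, 'k, 'w::ab_group_add) rep \<Rightarrow> ('v \<Rightarrow> 'w) set" where
  "Hom_G G M N = {f. G_morphism G M N f \<and> (\<forall>x. x \<notin> carrier M \<longrightarrow> f x = 0)}"

definition scl_fun :: "('k \<Rightarrow> 'w \<Rightarrow> 'w) \<Rightarrow> 'k \<Rightarrow> ('v \<Rightarrow> 'w) \<Rightarrow> 'v \<Rightarrow> 'w" where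
  "scl_fun s a f = (\<lambda>x. s a (f x))"

definition direct_sum ::
  "('k::field, 'v::ab_group_add, 'y) vect_scheme \<Rightarrow> 'r set \<Rightarrow> ('r \<Rightarrow> 'v set) \<Rightarrow> bool" where
  "direct_sum M R U \<longleftrightarrow>
     (\<forall>r\<in>R. U r \<subseteq> carrier M \<and> module.subspace (scl M) (U r)) \<and>
     (\<forall>x\<in>carrier M. \<exists>!p. finite {r. p r \<noteq> 0} \<and> (\<forall>r\<in>R. p r \<in> U r) \<and> (\<forall>r. r \<notin> R \<longrightarrow> p r = 0) \<and>
        x = (\<Sum>r | p r \<noteq> 0. p r))"

definition completely_reducible ::
  "('g, 'm) monoid_scheme \<Rightarrow> ('g, 'k::field, 'v::ab_group_add) rep \<Rightarrow> bool" where
  "completely_reducible G M \<longleftrightarrow>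
     (\<exists>\<D>. direct_sum M \<D> (\<lambda>S. S) \<and> (\<forall>S\<in>\<D>. is_submodule G M S \<and> is_irreducible G (sub_rep M S)))"

text \<open>
  Every finite dimensional space over \<open>'k\<close> is isomorphic to a subspace of \<open>nat \<Rightarrow> 'k\<close>, so
  quantifying over representations carried by that type exhausts \<open>Rep(G)\<close> up to isomorphism.
\<close>

type_synonym ('g, 'k) rep_obj = "('g, 'k, nat \<Rightarrow> 'k) rep"

definition fd_reps_completely_reducible ::
  "('g, 'm) monoid_scheme \<Rightarrow> 'k::field itself \<Rightarrow> bool" where
  "fd_reps_completely_reducible G _ \<longleftrightarrow>
     (\<forall>M :: ('g, 'k) rep_obj. is_rep G M \<and> fin_dim M \<longrightarrow> completely_reducible G M)"

section \<open>Tensor products\<close>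

text \<open>
  \<open>V \<otimes> W\<close> is realised inside the dual of the space of bilinear forms on \<open>V \<times> W\<close>, as the span of the
  evaluations \<open>v \<otimes> w : \<beta> \<mapsto> \<beta> v w\<close>.  (Functions \<open>\<beta>\<close> that are not bilinear on the carriers are
  sent to \<open>0\<close>.)  The group acts by \<open>g (v \<otimes> w) = g v \<otimes> g w\<close>; see \<open>act_pure_tensor\<close> and
  \<open>tensor_universal\<close> below.
\<close>

type_synonym ('k, 'v, 'w) tensor = "('v \<Rightarrow> 'w \<Rightarrow> 'k) \<Rightarrow> 'k"

definition ground_field :: "('k::field, 'k) vect" where
  "ground_field = \<lparr>carrier = UNIV, scl = (*)\<rparr>"

definition pure_tensor ::
  "('k::field, 'v::ab_group_add, 'y) vect_scheme \<Rightarrow> ('k, 'w::ab_group_add, 'z) vect_scheme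
    \<Rightarrow> 'v \<Rightarrow> 'w \<Rightarrow> ('k, 'v, 'w) tensor" where
  "pure_tensor M N v w = (\<lambda>\<beta>. if bilinear_map M N ground_field \<beta> then \<beta> v w else 0)"

definition tensor_rep ::
  "('g, 'k::field, 'v::ab_group_add) rep \<Rightarrow> ('g, 'k, 'w::ab_group_add) rep
    \<Rightarrow> ('g, 'k, ('k, 'v, 'w) tensor) rep" where
  "tensor_rep M N =
     \<lparr>carrier = module.span (scl_fun (*)) {pure_tensor M N v w |v w. v \<in> carrier M \<and> w \<in> carrier N},
      scl = scl_fun (*),
      act = (\<lambda>g t \<beta>. t (\<lambda>v w. \<beta> (act M g v) (act N g w)))\<rparr>"

lemma vector_space_tensor: "vector_space (scl_fun ((*) :: 'k::field \<Rightarrow> _) :: 'k \<Rightarrow> ('x \<Rightarrow> 'k) \<Rightarrow> _)"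
  by unfold_locales (auto simp: scl_fun_def fun_eq_iff algebra_simps)

lemma bilinear_form_act:
  assumes M: "is_rep G M" and N: "is_rep G N" and g: "g \<in> carrier G"
    and b: "bilinear_map M N ground_field \<beta>"
  shows "bilinear_map M N ground_field (\<lambda>v w. \<beta> (act M g v) (act N g w))"
  using M N g b
  by (auto simp: is_rep_def bilinear_map_def linear_map_def ground_field_def)

lemma bilinear_form_cong:
  assumes M: "is_vect M" and N: "is_vect N" and b: "bilinear_map M N ground_field \<beta>"
    and eq: "\<And>v w. v \<in> carrier M \<Longrightarrow> w \<in> carrier N \<Longrightarrow> \<beta>' v w = \<beta> v w"
  shows "bilinear_map M N ground_field \<beta>'"
proof -
  interpret m: vector_space "scl M" using M by (simp add: is_vect_def)
  interpret n: vector_space "scl N" using N by (simp add: is_vect_def)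
  have "m.subspace (carrier M)" "n.subspace (carrier N)" using M N by (auto simp: is_vect_def)
  then show ?thesis using b eq
    by (auto simp: bilinear_map_def linear_map_def ground_field_def m.subspace_add m.subspace_scale
        n.subspace_add n.subspace_scale)
qed

lemma act_pure_tensor:
  fixes M :: "('g, 'k::field, 'v::ab_group_add) rep" and N :: "('g, 'k, 'w::ab_group_add) rep"
  assumes G: "group G" and M: "is_rep G M" and N: "is_rep G N" and g: "g \<in> carrier G"
    and v: "v \<in> carrier M" and w: "w \<in> carrier N"
  shows "act (tensor_rep M N) g (pure_tensor M N v w) = pure_tensor M N (act M g v) (act N g w)"
proof
  fix \<beta> :: "'v \<Rightarrow> 'w \<Rightarrow> 'k"
  interpret group G by fact
  let ?\<beta> = "\<lambda>v w. \<beta> (act M g v) (act N g w)"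
  have inv: "act M g (act M (inv\<^bsub>G\<^esub> g) x) = x" if "x \<in> carrier M" for x
    using M g that by (metis is_rep_def inv_closed r_inv)
  have inv': "act N g (act N (inv\<^bsub>G\<^esub> g) x) = x" if "x \<in> carrier N" for x
    using N g that by (metis is_rep_def inv_closed r_inv)
  have "bilinear_map M N ground_field \<beta>" if "bilinear_map M N ground_field ?\<beta>"
  proof (rule bilinear_form_cong)
    show "is_vect M" "is_vect N" using M N by (auto simp: is_rep_def)
    show "bilinear_map M N ground_field
      (\<lambda>v w. ?\<beta> (act M (inv\<^bsub>G\<^esub> g) v) (act N (inv\<^bsub>G\<^esub> g) w))"
      using bilinear_form_act[OF M N inv_closed[OF g] that] .
  qed (auto simp: inv inv')
  then have "bilinear_map M N ground_field ?\<beta> \<longleftrightarrow> bilinear_map M N ground_field \<beta>"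
    using bilinear_form_act[OF M N g] by blast
  then show "act (tensor_rep M N) g (pure_tensor M N v w) \<beta> =
      pure_tensor M N (act M g v) (act N g w) \<beta>"
    by (simp add: tensor_rep_def pure_tensor_def)
qed

lemma tensor_universal:
  fixes M :: "('g, 'k::field, 'v::ab_group_add) rep" and N :: "('g, 'k, 'w::ab_group_add) rep"
    and P :: "('k, 'p::ab_group_add, 'z) vect_scheme"
  assumes P: "is_vect P" and b: "bilinear_map M N P b"
  shows "\<exists>!f. linear_map (tensor_rep M N) P f \<and> (\<forall>t. t \<notin> carrier (tensor_rep M N) \<longrightarrow> f t = 0) \<and>
    (\<forall>v\<in>carrier M. \<forall>w\<in>carrier N. f (pure_tensor M N v w) = b v w)"
proof -
  let ?s = "scl_fun (*) :: 'k \<Rightarrow> ('k, 'v, 'w) tensor \<Rightarrow> _"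
  let ?S = "{pure_tensor M N v w |v w. v \<in> carrier M \<and> w \<in> carrier N}"
  interpret t: vector_space ?s by (rule vector_space_tensor)
  interpret p: vector_space "scl P" using P by (simp add: is_vect_def)
  interpret k: vector_space "(*) :: 'k \<Rightarrow> 'k \<Rightarrow> 'k" by unfold_locales (auto simp: algebra_simps)
  interpret tp: vector_space_pair ?s "scl P" ..
  interpret pk: vector_space_pair "scl P" "(*) :: 'k \<Rightarrow> 'k \<Rightarrow> 'k" ..
  have subP: "p.subspace (carrier P)" using P by (simp add: is_vect_def)
  have bP: "b v w \<in> carrier P" if "v \<in> carrier M" "w \<in> carrier N" for v w
    using b that by (auto simp: bilinear_map_def linear_map_def)
  have carT: "carrier (tensor_rep M N) = t.span ?S" and sclT: "scl (tensor_rep M N) = ?s"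
    by (simp_all add: tensor_rep_def)
  obtain B where B: "B \<subseteq> ?S" "t.independent B" "?S \<subseteq> t.span B"
    using t.maximal_independent_subset by blast
  have spanB: "t.span B = t.span ?S"
    using B by (meson subset_antisym t.span_mono t.span_minimal t.subspace_span)
  have "\<forall>x\<in>B. \<exists>v w. x = pure_tensor M N v w \<and> v \<in> carrier M \<and> w \<in> carrier N" using B(1) by blast
  then obtain V W where VW: "\<And>x. x \<in> B \<Longrightarrow> x = pure_tensor M N (V x) (W x)"
    "\<And>x. x \<in> B \<Longrightarrow> V x \<in> carrier M" "\<And>x. x \<in> B \<Longrightarrow> W x \<in> carrier N" by metis
  obtain f0 where f0: "Vector_Spaces.linear ?s (scl P) f0"
    and f0B: "\<And>x. x \<in> B \<Longrightarrow> f0 x = b (V x) (W x)"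
    using tp.linear_independent_extend[OF B(2), of "\<lambda>x. b (V x) (W x)"] by blast
  interpret f0: Vector_Spaces.linear ?s "scl P" f0 by (rule f0)
  have f0_pure: "f0 (pure_tensor M N v w) = b v w" if vw: "v \<in> carrier M" "w \<in> carrier N" for v w
  proof (rule ccontr)
    assume ne: "f0 (pure_tensor M N v w) \<noteq> b v w"
    define u where "u = f0 (pure_tensor M N v w) - b v w"
    have "pure_tensor M N v w \<in> t.span B" using B(3) vw by blast
    then obtain F c where F: "finite F" "F \<subseteq> B" "pure_tensor M N v w = (\<Sum>x\<in>F. ?s (c x) x)"
      unfolding t.span_explicit by blast
    have "p.independent {u}" using ne by (simp add: u_def p.independent_insert)
    then obtain l where l: "Vector_Spaces.linear (scl P) (*) l" and "l u = 1"
      using pk.linear_independent_extend[of "{u}" "\<lambda>_. 1"] by auto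
    interpret l: Vector_Spaces.linear "scl P" "(*)" l by (rule l)
    let ?\<beta> = "\<lambda>v w. l (b v w)"
    have bil: "bilinear_map M N ground_field ?\<beta>"
      using b by (auto simp: bilinear_map_def linear_map_def ground_field_def l.add l.scale)
    have ev: "(\<Sum>x\<in>F. ?s (c x) x) \<beta> = (\<Sum>x\<in>F. c x * x \<beta>)" for \<beta>
      using F(1) by (induction F rule: finite_induct) (auto simp: scl_fun_def)
    have xb: "x ?\<beta> = ?\<beta> (V x) (W x)" if "x \<in> F" for x
    proof -
      have "x = pure_tensor M N (V x) (W x)" using that F(2) VW(1) by blast
      then have "x ?\<beta> = pure_tensor M N (V x) (W x) ?\<beta>" by simp
      then show ?thesis using bil by (simp add: pure_tensor_def)
    qed
    have "?\<beta> v w = pure_tensor M N v w ?\<beta>" using bil by (simp add: pure_tensor_def)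
    also have "\<dots> = (\<Sum>x\<in>F. c x * ?\<beta> (V x) (W x))" unfolding F(3) ev using xb by simp
    also have "\<dots> = l (\<Sum>x\<in>F. scl P (c x) (b (V x) (W x)))" by (simp add: l.sum l.scale)
    also have "(\<Sum>x\<in>F. scl P (c x) (b (V x) (W x))) = f0 (pure_tensor M N v w)"
    proof -
      have "f0 x = b (V x) (W x)" if "x \<in> F" for x using f0B F(2) that by blast
      then show ?thesis unfolding F(3) by (simp add: f0.sum f0.scale)
    qed
    finally have "l u = 0" by (simp add: u_def l.diff)
    with \<open>l u = 1\<close> show False by simp
  qed
  have f0_car: "f0 x \<in> carrier P" if "x \<in> t.span ?S" for x
    using that
  proof (induction rule: t.span_induct_alt)
    case base show ?case unfolding f0.zero using subP by (rule p.subspace_0)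
  next
    case (step a x y) then show ?case
      unfolding f0.add f0.scale using f0_pure bP subP
      by (auto intro!: p.subspace_add p.subspace_scale)
  qed
  define f where "f = (\<lambda>x. if x \<in> t.span ?S then f0 x else 0)"
  show ?thesis
  proof (rule ex1I[of _ f])
    show "linear_map (tensor_rep M N) P f \<and> (\<forall>t. t \<notin> carrier (tensor_rep M N) \<longrightarrow> f t = 0) \<and>
      (\<forall>v\<in>carrier M. \<forall>w\<in>carrier N. f (pure_tensor M N v w) = b v w)"
    proof (intro conjI ballI)
      show "linear_map (tensor_rep M N) P f"
        unfolding linear_map_def carT sclT
        by (auto simp: f_def f0_car f0.add f0.scale t.span_add t.span_scale)
      show "\<forall>t. t \<notin> carrier (tensor_rep M N) \<longrightarrow> f t = 0" unfolding carT by (auto simp: f_def)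
      show "f (pure_tensor M N v w) = b v w" if "v \<in> carrier M" "w \<in> carrier N" for v w
      proof -
        have "pure_tensor M N v w \<in> t.span ?S" using that by (blast intro: t.span_base)
        then show ?thesis by (simp add: f_def f0_pure that)
      qed
    qed
  next
    fix h
    assume h: "linear_map (tensor_rep M N) P h \<and> (\<forall>t. t \<notin> carrier (tensor_rep M N) \<longrightarrow> h t = 0) \<and>
      (\<forall>v\<in>carrier M. \<forall>w\<in>carrier N. h (pure_tensor M N v w) = b v w)"
    have add: "h (x + y) = h x + h y" if "x \<in> t.span ?S" "y \<in> t.span ?S" for x y
      using h that unfolding linear_map_def carT by blast
    have scale: "h (?s a x) = scl P a (h x)" if "x \<in> t.span ?S" for a x
      using h that unfolding linear_map_def carT sclT by blast
    have "h 0 = 0" using add[of 0 0] by (simp add: t.span_zero)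
    have "h x = f0 x" if "x \<in> t.span ?S" for x
    proof -
      have "x \<in> t.span ?S \<and> h x = f0 x" using that
      proof (induction rule: t.span_induct_alt)
        case base show ?case using \<open>h 0 = 0\<close> t.span_zero f0.zero by metis
      next
        case (step a x y)
        then have x: "x \<in> t.span ?S" by (blast intro: t.span_base)
        have "h x = f0 x" using step(1) h f0_pure by auto
        have ax: "?s a x \<in> t.span ?S" using x by (rule t.span_scale)
        have y: "y \<in> t.span ?S" "h y = f0 y" using step by blast+
        have "h (?s a x + y) = f0 (?s a x + y)"
          unfolding add[OF ax y(1)] scale[OF x] f0.add f0.scale
          using \<open>h x = f0 x\<close> y(2) by metis
        then show ?case using t.span_add[OF ax y(1)] by blast
      qed
      then show ?thesis by simp
    qed
    moreover have "h x = 0" if "x \<notin> t.span ?S" for x using h that carT by blast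
    ultimately show "h = f" by (auto simp: f_def)
  qed
qed

section \<open>Labelings of Rep(G)\<close>

record ('g, 'k, 'i, 'v) labeling =
  lab_set :: "'i set"
  lab_rep :: "'i \<Rightarrow> ('g, 'k, 'v) rep"
  lab_hom :: "'i \<Rightarrow> 'i \<Rightarrow> 'i \<Rightarrow> nat \<Rightarrow> ('k, 'v, 'v) tensor \<Rightarrow> 'v"

definition tensor_Hom ::
  "('g, 'm) monoid_scheme \<Rightarrow> ('g, 'k::field, 'i, 'v::ab_group_add) labeling
    \<Rightarrow> 'i \<Rightarrow> 'i \<Rightarrow> 'i \<Rightarrow> (('k, 'v, 'v) tensor \<Rightarrow> 'v) set" where
  "tensor_Hom G L i1 i2 j = Hom_G G (tensor_rep (lab_rep L i1) (lab_rep L i2)) (lab_rep L j)"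

definition hom_dim ::
  "('g, 'm) monoid_scheme \<Rightarrow> ('g, 'k::field, 'i, 'v::ab_group_add) labeling
    \<Rightarrow> 'i \<Rightarrow> 'i \<Rightarrow> 'i \<Rightarrow> nat" where
  "hom_dim G L i1 i2 j =
     vector_space.dim (scl_fun (scl (lab_rep L j))) (tensor_Hom G L i1 i2 j)"

definition is_labeling ::
  "('g, 'm) monoid_scheme \<Rightarrow> ('g, 'k::field, 'i, 'v::ab_group_add) labeling \<Rightarrow> bool" where
  "is_labeling G L \<longleftrightarrow>
     (\<forall>i\<in>lab_set L. is_irreducible G (lab_rep L i) \<and> fin_dim (lab_rep L i)) \<and>
     (\<forall>i\<in>lab_set L. \<forall>j\<in>lab_set L. isomorphic_reps G (lab_rep L i) (lab_rep L j) \<longrightarrow> i = j) \<and>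
     (\<forall>M :: ('g, 'k) rep_obj. is_irreducible G M \<and> fin_dim M \<longrightarrow>
        (\<exists>i\<in>lab_set L. isomorphic_reps G M (lab_rep L i))) \<and>
     (\<forall>i1\<in>lab_set L. \<forall>i2\<in>lab_set L. \<forall>j\<in>lab_set L.
        let m = lab_hom L i1 i2 j; d = hom_dim G L i1 i2 j; s = scl_fun (scl (lab_rep L j)) in
        inj_on m {1..d} \<and> \<not> module.dependent s (m ` {1..d}) \<and>
        module.span s (m ` {1..d}) = tensor_Hom G L i1 i2 j)"

text \<open>Only the values of a choice at triples with \<open>hom_dim \<ge> 1\<close> are ever used.\<close>

definition is_choice ::
  "('g, 'm) monoid_scheme \<Rightarrow> ('g, 'k::field, 'i, 'v::ab_group_add) labeling
    \<Rightarrow> ('i \<Rightarrow> 'i \<Rightarrow> 'i \<Rightarrow> nat) \<Rightarrow> bool" where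
  "is_choice G L Q \<longleftrightarrow>
     (\<forall>i1\<in>lab_set L. \<forall>i2\<in>lab_set L. \<forall>j\<in>lab_set L.
        1 \<le> hom_dim G L i1 i2 j \<longrightarrow> Q i1 i2 j \<in> {1..hom_dim G L i1 i2 j})"

section \<open>G-algebras\<close>

definition algebra_hom ::
  "('k::field, 'v::ab_group_add, 'y) vect_scheme \<Rightarrow> ('v \<Rightarrow> 'v \<Rightarrow> 'v)
    \<Rightarrow> ('k, 'w::ab_group_add, 'z) vect_scheme \<Rightarrow> ('w \<Rightarrow> 'w \<Rightarrow> 'w) \<Rightarrow> ('v \<Rightarrow> 'w) \<Rightarrow> bool" where
  "algebra_hom M \<mu> N \<nu> f \<longleftrightarrow>
     linear_map M N f \<and> (\<forall>x\<in>carrier M. \<forall>y\<in>carrier M. f (\<mu> x y) = \<nu> (f x) (f y))"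

definition G_algebra ::
  "('g, 'm) monoid_scheme \<Rightarrow> ('g, 'k::field, 'a::ab_group_add) rep \<Rightarrow> ('a \<Rightarrow> 'a \<Rightarrow> 'a) \<Rightarrow> bool" where
  "G_algebra G A \<mu> \<longleftrightarrow>
     is_rep G A \<and> bilinear_map A A A \<mu> \<and>
     (\<forall>g\<in>carrier G. algebra_hom A \<mu> A \<mu> (act A g)) \<and>
     (\<exists>\<D>. direct_sum A \<D> (\<lambda>S. S) \<and>
        (\<forall>S\<in>\<D>. is_submodule G A S \<and> is_irreducible G (sub_rep A S) \<and> fin_dim (sub_rep A S)))"

definition G_algebra_morphism ::
  "('g, 'm) monoid_scheme \<Rightarrow> ('g, 'k::field, 'a::ab_group_add) rep \<Rightarrow> ('a \<Rightarrow> 'a \<Rightarrow> 'a)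
    \<Rightarrow> ('g, 'k, 'b::ab_group_add) rep \<Rightarrow> ('b \<Rightarrow> 'b \<Rightarrow> 'b) \<Rightarrow> ('a \<Rightarrow> 'b) \<Rightarrow> bool" where
  "G_algebra_morphism G A \<mu> B \<nu> \<phi> \<longleftrightarrow> algebra_hom A \<mu> B \<nu> \<phi> \<and> G_morphism G A B \<phi>"

text \<open>
  A decomposition of \<open>A\<close>: the index set \<open>R\<close>, the summands \<open>A\<^sub>r\<close>, their labels \<open>\<epsilon>(r)\<close>, and the
  isomorphisms \<open>\<tau>\<^sub>r : V\<^bsub>\<epsilon>(r)\<^esub> \<rightarrow> A\<^sub>r\<close>.
\<close>

record ('i, 'v, 'r, 'a) decomposition =
  ind :: "'r set"
  summand :: "'r \<Rightarrow> 'a set"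
  label :: "'r \<Rightarrow> 'i"
  tau :: "'r \<Rightarrow> 'v \<Rightarrow> 'a"

definition is_decomposition ::
  "('g, 'm) monoid_scheme \<Rightarrow> ('g, 'k::field, 'i, 'v::ab_group_add) labeling
    \<Rightarrow> ('g, 'k, 'a::ab_group_add) rep \<Rightarrow> ('i, 'v, 'r, 'a) decomposition \<Rightarrow> bool" where
  "is_decomposition G L A D \<longleftrightarrow>
     direct_sum A (ind D) (summand D) \<and>
     (\<forall>r\<in>ind D. is_submodule G A (summand D r) \<and> is_irreducible G (sub_rep A (summand D r)) \<and>
        label D r \<in> lab_set L \<and>
        G_isomorphism G (lab_rep L (label D r)) (sub_rep A (summand D r)) (tau D r))"

definition tau_inv ::
  "('g, 'k, 'i, 'v) labeling \<Rightarrow> ('i, 'v, 'r, 'a) decomposition \<Rightarrow> 'r \<Rightarrow> 'a \<Rightarrow> 'v" where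
  "tau_inv L D r = inv_into (carrier (lab_rep L (label D r))) (tau D r)"

abbreviation hom_dim3 ::
  "('g, 'm) monoid_scheme \<Rightarrow> ('g, 'k::field, 'i, 'v::ab_group_add) labeling
    \<Rightarrow> ('i, 'v, 'r, 'a) decomposition \<Rightarrow> 'r \<Rightarrow> 'r \<Rightarrow> 'r \<Rightarrow> nat" where
  "hom_dim3 G L D r1 r2 s \<equiv> hom_dim G L (label D r1) (label D r2) (label D s)"

section \<open>The G-table and the algebras P(A, Q)\<close>

text \<open>
  The defining equation of the G-table is an equation of linear maps on \<open>A\<^bsub>r1\<^esub> \<otimes> A\<^bsub>r2\<^esub>\<close>; it is
  written on the pure tensors \<open>a \<otimes> b\<close>, which span that space.  For fixed \<open>r1\<close>, \<open>r2\<close> only finitely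
  many coefficients are nonzero.  Coefficients outside the index range are normalised to \<open>0\<close>, so
  that the table is unique as a function.
\<close>

definition is_G_table ::
  "('g, 'm) monoid_scheme \<Rightarrow> ('g, 'k::field, 'i, 'v::ab_group_add) labeling
    \<Rightarrow> ('g, 'k, 'a::ab_group_add) rep \<Rightarrow> ('a \<Rightarrow> 'a \<Rightarrow> 'a) \<Rightarrow> ('i, 'v, 'r, 'a) decomposition
    \<Rightarrow> ('r \<Rightarrow> 'r \<Rightarrow> 'r \<Rightarrow> nat \<Rightarrow> 'k) \<Rightarrow> bool" where
  "is_G_table G L A \<mu> D c \<longleftrightarrow>
     (\<forall>r1 r2 s q. \<not> (r1 \<in> ind D \<and> r2 \<in> ind D \<and> s \<in> ind D \<and> q \<in> {1..hom_dim3 G L D r1 r2 s}) \<longrightarrow>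
        c r1 r2 s q = 0) \<and>
     (\<forall>r1\<in>ind D. \<forall>r2\<in>ind D.
        finite {s. \<exists>q. c r1 r2 s q \<noteq> 0} \<and>
        (\<forall>a\<in>summand D r1. \<forall>b\<in>summand D r2.
           \<mu> a b =
           (\<Sum>s | s \<in> ind D \<and> (\<exists>q. c r1 r2 s q \<noteq> 0). \<Sum>q = 1..hom_dim3 G L D r1 r2 s.
              scl A (c r1 r2 s q)
                (tau D s (lab_hom L (label D r1) (label D r2) (label D s) q
                   (pure_tensor (lab_rep L (label D r1)) (lab_rep L (label D r2))
                      (tau_inv L D r1 a) (tau_inv L D r2 b)))))))"

definition G_table ::
  "('g, 'm) monoid_scheme \<Rightarrow> ('g, 'k::field, 'i, 'v::ab_group_add) labeling
    \<Rightarrow> ('g, 'k, 'a::ab_group_add) rep \<Rightarrow> ('a \<Rightarrow> 'a \<Rightarrow> 'a) \<Rightarrow> ('i, 'v, 'r, 'a) decomposition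
    \<Rightarrow> 'r \<Rightarrow> 'r \<Rightarrow> 'r \<Rightarrow> nat \<Rightarrow> 'k" where
  "G_table G L A \<mu> D = (THE c. is_G_table G L A \<mu> D c)"

text \<open>\<open>P(A)\<close> consists of the finitely supported functions on \<open>R\<close>; \<open>e\<^sub>r\<close> is \<open>Poly_Mapping.single r 1\<close>.\<close>

definition scl_pm :: "'k::field \<Rightarrow> ('r \<Rightarrow>\<^sub>0 'k) \<Rightarrow> 'r \<Rightarrow>\<^sub>0 'k" where
  "scl_pm a = Poly_Mapping.map ((*) a)"

definition P_space :: "('i, 'v, 'r, 'a) decomposition \<Rightarrow> ('k::field, 'r \<Rightarrow>\<^sub>0 'k) vect" where
  "P_space D = \<lparr>carrier = {p. Poly_Mapping.keys p \<subseteq> ind D}, scl = scl_pm\<rparr>"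

definition P_basis :: "'r \<Rightarrow> 'r \<Rightarrow>\<^sub>0 'k::field" where
  "P_basis r = Poly_Mapping.single r 1"

definition P_basis_mult ::
  "('g, 'm) monoid_scheme \<Rightarrow> ('g, 'k::field, 'i, 'v::ab_group_add) labeling
    \<Rightarrow> ('g, 'k, 'a::ab_group_add) rep \<Rightarrow> ('a \<Rightarrow> 'a \<Rightarrow> 'a) \<Rightarrow> ('i, 'v, 'r, 'a) decomposition
    \<Rightarrow> ('i \<Rightarrow> 'i \<Rightarrow> 'i \<Rightarrow> nat) \<Rightarrow> 'r \<Rightarrow> 'r \<Rightarrow> 'r \<Rightarrow>\<^sub>0 'k" where
  "P_basis_mult G L A \<mu> D Q r1 r2 =
     (let c = (\<lambda>s. G_table G L A \<mu> D r1 r2 s (Q (label D r1) (label D r2) (label D s))) in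
      \<Sum>s | s \<in> ind D \<and> 1 \<le> hom_dim3 G L D r1 r2 s \<and> c s \<noteq> 0. scl_pm (c s) (P_basis s))"

definition P_mult ::
  "('g, 'm) monoid_scheme \<Rightarrow> ('g, 'k::field, 'i, 'v::ab_group_add) labeling
    \<Rightarrow> ('g, 'k, 'a::ab_group_add) rep \<Rightarrow> ('a \<Rightarrow> 'a \<Rightarrow> 'a) \<Rightarrow> ('i, 'v, 'r, 'a) decomposition
    \<Rightarrow> ('i \<Rightarrow> 'i \<Rightarrow> 'i \<Rightarrow> nat) \<Rightarrow> ('r \<Rightarrow>\<^sub>0 'k) \<Rightarrow> ('r \<Rightarrow>\<^sub>0 'k) \<Rightarrow> 'r \<Rightarrow>\<^sub>0 'k" where
  "P_mult G L A \<mu> D Q p p' =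
     (\<Sum>r1\<in>Poly_Mapping.keys p. \<Sum>r2\<in>Poly_Mapping.keys p'.
        scl_pm (Poly_Mapping.lookup p r1 * Poly_Mapping.lookup p' r2)
          (P_basis_mult G L A \<mu> D Q r1 r2))"

section \<open>The G-matrix of a module morphism and P(\<open>\<phi>\<close>)\<close>

text \<open>
  \<open>f x r\<close> is the entry \<open>f\<^bsub>x,r\<^esub>\<close>.  A \<open>G\<close>-morphism has a G-matrix as soon as
  \<open>End\<^sub>G(V\<^sub>i) = \<bbbK>\<close> for the labels involved; over a general field this is not automatic.
\<close>

definition is_G_matrix ::
  "('g, 'k::field, 'i, 'v::ab_group_add) labeling
    \<Rightarrow> ('i, 'v, 'r, 'a::ab_group_add) decomposition
    \<Rightarrow> ('g, 'k, 'b::ab_group_add) rep \<Rightarrow> ('i, 'v, 'x, 'b) decomposition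
    \<Rightarrow> ('a \<Rightarrow> 'b) \<Rightarrow> ('x \<Rightarrow> 'r \<Rightarrow> 'k) \<Rightarrow> bool" where
  "is_G_matrix L D B E \<phi> f \<longleftrightarrow>
     (\<forall>x r. \<not> (r \<in> ind D \<and> x \<in> ind E \<and> label E x = label D r) \<longrightarrow> f x r = 0) \<and>
     (\<forall>r\<in>ind D.
        finite {x. f x r \<noteq> 0} \<and>
        (\<forall>a\<in>summand D r.
           \<phi> a = (\<Sum>x | x \<in> ind E \<and> label E x = label D r \<and> f x r \<noteq> 0.
                    scl B (f x r) (tau E x (tau_inv L D r a)))))"

definition P_map ::
  "('i, 'v, 'x, 'b) decomposition \<Rightarrow> ('x \<Rightarrow> 'r \<Rightarrow> 'k::field) \<Rightarrow> ('r \<Rightarrow>\<^sub>0 'k) \<Rightarrow> 'x \<Rightarrow>\<^sub>0 'k" where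
  "P_map E f p =
     (\<Sum>r\<in>Poly_Mapping.keys p.
        scl_pm (Poly_Mapping.lookup p r)
          (\<Sum>x | x \<in> ind E \<and> f x r \<noteq> 0. scl_pm (f x r) (P_basis x)))"

end

theory Submission
  imports Defs
begin

text \<open>
  Both sides of the equivalence say that the same two families of scalars agree.  Fix summands
  \<open>A\<^bsub>r1\<^esub>\<close>, \<open>A\<^bsub>r2\<^esub>\<close> of the source and a summand \<open>B\<^bsub>y\<^esub>\<close> of the target, transport everything to the
  representatives \<open>V\<^sub>i\<close> along the chosen isomorphisms, and look at the \<open>y\<close>-component of the two bilinear
  maps \<open>\<phi> \<circ> \<mu>\<close> and \<open>\<nu> \<circ> (\<phi> \<times> \<phi>)\<close>.  Each is a combination of the basis
  \<open>m\<^sub>1, ..., m\<^sub>d\<close> of \<open>Hom\<^sub>G(V\<^bsub>\<epsilon>(r1)\<^esub> \<otimes> V\<^bsub>\<epsilon>(r2)\<^esub>, V\<^bsub>\<epsilon>(y)\<^esub>)\<close>, because the G-matrix only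
  links summands with equal labels, so that \<open>\<phi>\<close> acts on each \<open>m\<^sub>q\<close> by scalars.  The coefficients of
  \<open>m\<^sub>q\<close> are, with \<open>c\<close> and \<open>c'\<close> the G-tables of source and target,

    \<open>\<Sum>s. f y s * c r1 r2 s q\<close>  (\<open>component_morphism_mult\<close>)  and
    \<open>\<Sum>x1. \<Sum>x2. f x1 r1 * f x2 r2 * c' x1 x2 y q\<close>  (\<open>component_mult_morphism\<close>).

  The \<open>m\<^sub>q\<close> are linearly independent, so \<open>\<phi>\<close> is multiplicative exactly when these scalars agree for
  all \<open>r1\<close>, \<open>r2\<close>, \<open>y\<close>, \<open>q\<close> (\<open>algebra_hom_iff_coeff\<close>).  On the other side, the same two scalars with
  \<open>q = Q(\<epsilon>(r1), \<epsilon>(r2), \<epsilon>(y))\<close> are the coordinates at \<open>y\<close> of \<open>P(\<phi>)(e\<^bsub>r1\<^esub> \<cdot> e\<^bsub>r2\<^esub>)\<close> and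
  \<open>P(\<phi>)(e\<^bsub>r1\<^esub>) \<cdot> P(\<phi>)(e\<^bsub>r2\<^esub>)\<close> (\<open>P_algebra_hom_iff_coeff\<close>).  Every admissible \<open>q\<close> is the
  value of some choice at the given triple of labels, so the equalities for all \<open>Q\<close> are the equalities
  for all \<open>q\<close>.

  The G-table is a definite description, so its existence and uniqueness have to be shown first
  (\<open>ex1_G_table\<close>).  The projections onto the summands are equivariant; hence every block of \<open>\<mu>\<close>
  is an equivariant bilinear map between representatives, factors through the tensor product, and expands
  uniquely in the basis of the labeling.
\<close>

section \<open>Linear maps\<close>

lemma linear_mapD:
  assumes "linear_map M N f"
  shows "x \<in> carrier M \<Longrightarrow> f x \<in> carrier N"
    and "x \<in> carrier M \<Longrightarrow> y \<in> carrier M \<Longrightarrow> f (x + y) = f x + f y"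
    and "x \<in> carrier M \<Longrightarrow> f (scl M a x) = scl N a (f x)"
  using assms by (auto simp: linear_map_def)

lemma is_vect_closed:
  assumes "is_vect M"
  shows "0 \<in> carrier M"
    and "x \<in> carrier M \<Longrightarrow> y \<in> carrier M \<Longrightarrow> x + y \<in> carrier M"
    and "x \<in> carrier M \<Longrightarrow> scl M a x \<in> carrier M"
    and "(\<And>i. i \<in> I \<Longrightarrow> h i \<in> carrier M) \<Longrightarrow> sum h I \<in> carrier M"
proof -
  interpret vector_space "scl M" using assms by (simp add: is_vect_def)
  have sub: "subspace (carrier M)" using assms by (simp add: is_vect_def)
  show "0 \<in> carrier M"
    and "x \<in> carrier M \<Longrightarrow> y \<in> carrier M \<Longrightarrow> x + y \<in> carrier M"
    and "x \<in> carrier M \<Longrightarrow> scl M a x \<in> carrier M"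
    and "(\<And>i. i \<in> I \<Longrightarrow> h i \<in> carrier M) \<Longrightarrow> sum h I \<in> carrier M"
    using sub by (auto intro: subspace_0 subspace_add subspace_scale subspace_sum)
qed

lemma linear_map_zero:
  assumes "is_vect M" and f: "linear_map M N f"
  shows "f 0 = 0"
  using linear_mapD(2)[OF f, of 0 0] is_vect_closed(1)[OF assms(1)] by simp

lemma linear_map_sum:
  assumes M: "is_vect M" and f: "linear_map M N f"
    and x: "\<And>i. i \<in> I \<Longrightarrow> x i \<in> carrier M"
  shows "f (\<Sum>i\<in>I. x i) = (\<Sum>i\<in>I. f (x i))"
  using x
proof (induction I rule: infinite_finite_induct)
  case (insert i I)
  have "sum x I \<in> carrier M" using insert.prems by (intro is_vect_closed(4)[OF M]) auto
  then show ?case using insert linear_mapD(2)[OF f] by simp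
qed (auto intro: linear_map_zero[OF M f])

text \<open>
  Linearity is required on carriers only, so the usual uniqueness principle is restated in that form: the
  elements of the carrier on which both maps agree form a subspace.
\<close>

lemma linear_map_eq_on_span:
  assumes M: "vector_space (scl M)" and car: "carrier M = module.span (scl M) S"
    and f: "linear_map M N f" and h: "linear_map M N h"
    and eq: "\<And>x. x \<in> S \<Longrightarrow> f x = h x" and x: "x \<in> carrier M"
  shows "f x = h x"
proof -
  interpret vector_space "scl M" by fact
  have vM: "is_vect M" using M car by (simp add: is_vect_def)
  have "subspace {y \<in> carrier M. f y = h y}"
    unfolding subspace_def
    using linear_map_zero[OF vM f] linear_map_zero[OF vM h] linear_mapD(2,3)[OF f]
      linear_mapD(2,3)[OF h] is_vect_closed(1-3)[OF vM]
    by auto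
  moreover have "S \<subseteq> {y \<in> carrier M. f y = h y}"
    using eq car span_superset by auto
  ultimately have "span S \<subseteq> {y \<in> carrier M. f y = h y}" by (rule span_minimal[rotated])
  then show ?thesis using x car by blast
qed

lemma linear_map_comp:
  "linear_map M N f \<Longrightarrow> linear_map N P h \<Longrightarrow> linear_map M P (\<lambda>x. h (f x))"
  by (auto simp: linear_map_def)

lemma linear_map_zero_map:
  assumes "is_vect N"
  shows "linear_map M N (\<lambda>_. 0)"
proof -
  interpret vector_space "scl N" using assms by (simp add: is_vect_def)
  show ?thesis using is_vect_closed(1)[OF assms] by (simp add: linear_map_def)
qed

lemma bilinear_mapD:
  assumes "bilinear_map M N P b"
  shows "x \<in> carrier M \<Longrightarrow> linear_map N P (b x)"
    and "y \<in> carrier N \<Longrightarrow> linear_map M P (\<lambda>x. b x y)"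
  using assms by (auto simp: bilinear_map_def)

lemma bilinear_map_closed:
  "bilinear_map M N P b \<Longrightarrow> x \<in> carrier M \<Longrightarrow> y \<in> carrier N \<Longrightarrow> b x y \<in> carrier P"
  by (meson bilinear_mapD(1) linear_mapD(1))

lemma bilinear_map_sum_scale:
  assumes M: "is_vect M" and N: "is_vect N" and b: "bilinear_map M N P b"
    and P: "is_vect P"
    and x: "\<And>i. i \<in> I \<Longrightarrow> x i \<in> carrier M" and y: "\<And>j. j \<in> J \<Longrightarrow> y j \<in> carrier N"
  shows "b (\<Sum>i\<in>I. scl M (\<alpha> i) (x i)) (\<Sum>j\<in>J. scl N (\<beta> j) (y j)) =
    (\<Sum>i\<in>I. \<Sum>j\<in>J. scl P (\<alpha> i * \<beta> j) (b (x i) (y j)))"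
proof -
  interpret vector_space "scl P" using P by (simp add: is_vect_def)
  let ?y = "\<Sum>j\<in>J. scl N (\<beta> j) (y j)"
  have yc: "?y \<in> carrier N" using y by (intro is_vect_closed(4)[OF N]) (auto intro: is_vect_closed(3)[OF N])
  have "b (\<Sum>i\<in>I. scl M (\<alpha> i) (x i)) ?y = (\<Sum>i\<in>I. b (scl M (\<alpha> i) (x i)) ?y)"
    using x by (intro linear_map_sum[OF M bilinear_mapD(2)[OF b yc]]) (auto intro: is_vect_closed(3)[OF M])
  also have "\<dots> = (\<Sum>i\<in>I. scl P (\<alpha> i) (b (x i) ?y))"
    using x linear_mapD(3)[OF bilinear_mapD(2)[OF b yc]] by (intro sum.cong) auto
  also have "\<dots> = (\<Sum>i\<in>I. scl P (\<alpha> i) (\<Sum>j\<in>J. scl P (\<beta> j) (b (x i) (y j))))"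
  proof (intro sum.cong refl)
    fix i assume i: "i \<in> I"
    note l = bilinear_mapD(1)[OF b x[OF i]]
    have "b (x i) ?y = (\<Sum>j\<in>J. b (x i) (scl N (\<beta> j) (y j)))"
      using y by (intro linear_map_sum[OF N l]) (auto intro: is_vect_closed(3)[OF N])
    also have "\<dots> = (\<Sum>j\<in>J. scl P (\<beta> j) (b (x i) (y j)))"
      using y linear_mapD(3)[OF l] by (intro sum.cong) auto
    finally show "scl P (\<alpha> i) (b (x i) ?y) = scl P (\<alpha> i) (\<Sum>j\<in>J. scl P (\<beta> j) (b (x i) (y j)))"
      by simp
  qed
  finally show ?thesis by (simp add: scale_sum_right)
qed

text \<open>
  Reduces multiplicativity to spanning vectors: it is applied to the summands of a decomposed algebra, to
  the basis vectors of \<open>P(A)\<close>, and, against the zero map, to finite spanning sets of the \<open>V\<^sub>i\<close>.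
\<close>

lemma bilinear_map_eq_on_span:
  assumes M: "vector_space (scl M)" and N: "vector_space (scl N)"
    and S: "carrier M = module.span (scl M) S" and T: "carrier N = module.span (scl N) T"
    and b: "bilinear_map M N P b" and b': "bilinear_map M N P b'"
    and eq: "\<And>x y. x \<in> S \<Longrightarrow> y \<in> T \<Longrightarrow> b x y = b' x y"
    and x: "x \<in> carrier M" and y: "y \<in> carrier N"
  shows "b x y = b' x y"
proof (rule linear_map_eq_on_span[OF M S bilinear_mapD(2)[OF b y] bilinear_mapD(2)[OF b' y] _ x])
  interpret m: vector_space "scl M" by fact
  fix x assume "x \<in> S"
  then have "x \<in> carrier M" using S m.span_base by auto
  then show "b x y = b' x y"
    using linear_map_eq_on_span[OF N T bilinear_mapD(1)[OF b] bilinear_mapD(1)[OF b']] eq \<open>x \<in> S\<close> y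
    by blast
qed

section \<open>Components in a direct sum\<close>

locale internal_direct_sum =
  fixes M :: "('k::field, 'v::ab_group_add, 'y) vect_scheme" and R :: "'r set" and U :: "'r \<Rightarrow> 'v set"
  assumes vect: "is_vect M" and direct: "direct_sum M R U"
begin

sublocale vector_space "scl M" using vect by (simp add: is_vect_def)

lemma subspace_carrier: "subspace (carrier M)" using vect by (simp add: is_vect_def)

definition component :: "'v \<Rightarrow> 'r \<Rightarrow> 'v" where
  "component x = (THE p. finite {r. p r \<noteq> 0} \<and> (\<forall>r\<in>R. p r \<in> U r) \<and> (\<forall>r. r \<notin> R \<longrightarrow> p r = 0) \<and>
        x = (\<Sum>r | p r \<noteq> 0. p r))"

lemma summand_subset: "r \<in> R \<Longrightarrow> U r \<subseteq> carrier M"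
  and summand_subspace: "r \<in> R \<Longrightarrow> subspace (U r)"
  using direct by (auto simp: direct_sum_def)

lemma component:
  assumes "x \<in> carrier M"
  shows finite_component: "finite {r. component x r \<noteq> 0}"
    and component_in: "r \<in> R \<Longrightarrow> component x r \<in> U r"
    and component_out: "r \<notin> R \<Longrightarrow> component x r = 0"
    and sum_component: "(\<Sum>r | component x r \<noteq> 0. component x r) = x"
proof -
  have "\<exists>!p. finite {r. p r \<noteq> 0} \<and> (\<forall>r\<in>R. p r \<in> U r) \<and> (\<forall>r. r \<notin> R \<longrightarrow> p r = 0) \<and>
        x = (\<Sum>r | p r \<noteq> 0. p r)"
    using direct assms by (simp add: direct_sum_def)
  from theI'[OF this] show "finite {r. component x r \<noteq> 0}"
    and "r \<in> R \<Longrightarrow> component x r \<in> U r" and "r \<notin> R \<Longrightarrow> component x r = 0"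
    and "(\<Sum>r | component x r \<noteq> 0. component x r) = x"
    unfolding component_def[symmetric] by auto
qed

text \<open>
  The working form of uniqueness of decompositions: to compute a component, write the vector as a finite
  sum of elements of distinct summands.
\<close>

lemma component_of_sum:
  assumes F: "finite F" "F \<subseteq> R" and p: "\<And>r. r \<in> F \<Longrightarrow> p r \<in> U r"
  shows "component (\<Sum>r\<in>F. p r) s = (if s \<in> F then p s else 0)"
proof -
  let ?p = "\<lambda>r. if r \<in> F then p r else 0"
  let ?x = "\<Sum>r\<in>F. p r"
  have x: "?x \<in> carrier M"
    using F(2) p summand_subset by (intro is_vect_closed(4)[OF vect]) blast
  have "finite {r. ?p r \<noteq> 0}" using F(1) by (rule rev_finite_subset) auto
  moreover have "\<forall>r\<in>R. ?p r \<in> U r" using p summand_subspace by (auto intro: subspace_0)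
  moreover have "\<forall>r. r \<notin> R \<longrightarrow> ?p r = 0" using F(2) by auto
  moreover have "?x = (\<Sum>r | ?p r \<noteq> 0. ?p r)"
    using F(1) by (intro sum.mono_neutral_cong_right) auto
  moreover have "\<exists>!p. finite {r. p r \<noteq> 0} \<and> (\<forall>r\<in>R. p r \<in> U r) \<and> (\<forall>r. r \<notin> R \<longrightarrow> p r = 0) \<and>
        ?x = (\<Sum>r | p r \<noteq> 0. p r)"
    using direct x by (simp add: direct_sum_def)
  ultimately have "component ?x = ?p" unfolding component_def by (intro the1_equality) auto
  then show ?thesis by simp
qed

lemma component_expand:
  assumes "x \<in> carrier M" "finite F" "{r. component x r \<noteq> 0} \<subseteq> F"
  shows "x = (\<Sum>r\<in>F. component x r)"
  using sum_component[OF assms(1)] sum.mono_neutral_left[OF assms(2,3), of "component x"] by auto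

lemma component_support_subset: "x \<in> carrier M \<Longrightarrow> {r. component x r \<noteq> 0} \<subseteq> R"
  using component_out by blast

lemma component_eqI:
  assumes x: "x \<in> carrier M" and y: "y \<in> carrier M"
    and eq: "\<And>r. r \<in> R \<Longrightarrow> component x r = component y r"
  shows "x = y"
proof -
  have "component x = component y"
  proof
    fix r show "component x r = component y r"
      by (cases "r \<in> R") (simp_all add: eq component_out[OF x] component_out[OF y])
  qed
  with sum_component[OF x] have "(\<Sum>r | component y r \<noteq> 0. component y r) = x" by (simp only:)
  then show ?thesis by (simp only: sum_component[OF y])
qed

lemma component_add:
  assumes x: "x \<in> carrier M" and y: "y \<in> carrier M"
  shows "component (x + y) s = component x s + component y s"
proof -
  let ?F = "{r. component x r \<noteq> 0} \<union> {r. component y r \<noteq> 0}"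
  have F: "finite ?F" "?F \<subseteq> R"
    using finite_component[OF x] finite_component[OF y]
      component_support_subset[OF x] component_support_subset[OF y] by auto
  have eq: "x + y = (\<Sum>r\<in>?F. component x r + component y r)"
    using component_expand[OF x F(1)] component_expand[OF y F(1)] by (simp add: sum.distrib)
  show ?thesis unfolding eq
    by (subst component_of_sum[OF F]) (use F(2) component_in x y summand_subspace subspace_add in auto)
qed

lemma component_scale:
  assumes x: "x \<in> carrier M"
  shows "component (scl M a x) s = scl M a (component x s)"
proof -
  let ?F = "{r. component x r \<noteq> 0}"
  have F: "finite ?F" "?F \<subseteq> R" using finite_component[OF x] component_support_subset[OF x] by auto
  have eq: "scl M a x = (\<Sum>r\<in>?F. scl M a (component x r))"
    using component_expand[OF x F(1)] by (metis order_refl scale_sum_right)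
  show ?thesis unfolding eq
    by (subst component_of_sum[OF F]) (use F(2) component_in x summand_subspace subspace_scale in auto)
qed

lemma linear_component: "s \<in> R \<Longrightarrow> linear_map M (M\<lparr>carrier := U s\<rparr>) (\<lambda>x. component x s)"
  by (auto simp: linear_map_def component_add component_scale component_in)

lemma component_sum:
  assumes "\<And>i. i \<in> I \<Longrightarrow> x i \<in> carrier M"
  shows "component (\<Sum>i\<in>I. x i) s = (\<Sum>i\<in>I. component (x i) s)"
proof (rule linear_map_sum[OF vect _ assms])
  show "linear_map M \<lparr>carrier = UNIV, scl = scl M\<rparr> (\<lambda>x. component x s)"
    by (auto simp: linear_map_def component_add component_scale)
qed

text \<open>
  A linear map that preserves every summand commutes with the projections; for the action of a group
  element this says that the projections are \<open>G\<close>-morphisms.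
\<close>

lemma component_equivariant:
  assumes h: "linear_map M M h" and U: "\<And>r y. r \<in> R \<Longrightarrow> y \<in> U r \<Longrightarrow> h y \<in> U r"
    and x: "x \<in> carrier M"
  shows "component (h x) s = h (component x s)"
proof -
  let ?F = "{r. component x r \<noteq> 0}"
  have F: "finite ?F" "?F \<subseteq> R" using finite_component[OF x] component_support_subset[OF x] by auto
  have "h x = h (\<Sum>r\<in>?F. component x r)" using component_expand[OF x F(1)] by simp
  also have "\<dots> = (\<Sum>r\<in>?F. h (component x r))"
    using F(2) component_in[OF x] summand_subset by (intro linear_map_sum[OF vect h]) blast
  finally have eq: "h x = (\<Sum>r\<in>?F. h (component x r))" .
  show ?thesis unfolding eq
    by (subst component_of_sum[OF F]) (use F(2) component_in x U linear_map_zero[OF vect h] in auto)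
qed

lemma carrier_eq_span: "carrier M = span (\<Union>r\<in>R. U r)"
proof
  show "span (\<Union>r\<in>R. U r) \<subseteq> carrier M"
    using summand_subset by (intro span_minimal[OF _ subspace_carrier]) blast
  show "carrier M \<subseteq> span (\<Union>r\<in>R. U r)"
  proof
    fix x assume x: "x \<in> carrier M"
    have "(\<Sum>r | component x r \<noteq> 0. component x r) \<in> span (\<Union>r\<in>R. U r)"
      using component_in[OF x] component_support_subset[OF x] by (intro span_sum span_base) blast
    then show "x \<in> span (\<Union>r\<in>R. U r)" by (simp add: sum_component[OF x])
  qed
qed

end

section \<open>Morphisms out of a tensor product\<close>

lemma vector_space_scl_fun:
  assumes "vector_space s"
  shows "vector_space (scl_fun s)"
proof -
  interpret vector_space s by fact
  show ?thesis by unfold_locales (auto simp: scl_fun_def fun_eq_iff algebra_simps scale_right_distrib scale_left_distrib)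
qed

lemma sum_fun_apply: "(\<Sum>i\<in>I. h i) x = (\<Sum>i\<in>I. h i x)"
  by (induction I rule: infinite_finite_induct) auto

lemma tensor_rep_simps:
  "carrier (tensor_rep M N) =
    module.span (scl (tensor_rep M N)) {pure_tensor M N v w |v w. v \<in> carrier M \<and> w \<in> carrier N}"
  "scl (tensor_rep M N) = scl_fun (*)"
  by (simp_all add: tensor_rep_def)

lemma vector_space_tensor_rep: "vector_space (scl (tensor_rep M N))"
  by (simp add: tensor_rep_simps(2) vector_space_tensor)

lemma pure_tensor_in:
  assumes "v \<in> carrier M" "w \<in> carrier N"
  shows "pure_tensor M N v w \<in> carrier (tensor_rep M N)"
proof -
  interpret vector_space "scl (tensor_rep M N)" by (rule vector_space_tensor_rep)
  show ?thesis using assms tensor_rep_simps(1)[of M N] by (auto intro: span_base)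
qed

lemma linear_map_tensor_eqI:
  assumes "linear_map (tensor_rep M N) P f" "linear_map (tensor_rep M N) P h"
    and "\<And>v w. v \<in> carrier M \<Longrightarrow> w \<in> carrier N \<Longrightarrow> f (pure_tensor M N v w) = h (pure_tensor M N v w)"
    and "t \<in> carrier (tensor_rep M N)"
  shows "f t = h t"
  by (rule linear_map_eq_on_span[OF vector_space_tensor_rep tensor_rep_simps(1) assms(1,2)])
    (use assms(3,4) in auto)

lemma linear_map_tensor_act:
  assumes G: "group G" and M: "is_rep G M" and N: "is_rep G N" and g: "g \<in> carrier G"
  shows "linear_map (tensor_rep M N) (tensor_rep M N) (act (tensor_rep M N) g)"
proof -
  let ?T = "tensor_rep M N"
  interpret vector_space "scl ?T" by (rule vector_space_tensor_rep)
  have lin: "act ?T g (s + t) = act ?T g s + act ?T g t"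
    "act ?T g (scl ?T a t) = scl ?T a (act ?T g t)" for s t a
    by (auto simp: tensor_rep_def scl_fun_def)
  have zero: "act ?T g 0 = 0" by (auto simp: tensor_rep_def)
  let ?S = "{pure_tensor M N v w |v w. v \<in> carrier M \<and> w \<in> carrier N}"
  have sub: "subspace {t. act ?T g t \<in> carrier ?T}"
    unfolding tensor_rep_simps(1)[of M N] subspace_def using zero lin span_zero span_add span_scale by auto
  have "?S \<subseteq> {t. act ?T g t \<in> carrier ?T}"
    using M N g by (auto simp: act_pure_tensor[OF G M N g] is_rep_def linear_map_def intro!: pure_tensor_in)
  from span_minimal[OF this sub] show ?thesis
    using lin unfolding linear_map_def tensor_rep_simps(1)[of M N] by auto
qed

text \<open>
  The linear map given by the universal property is again equivariant, because both sides of the equivariance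
  equation are linear and can be compared on pure tensors.
\<close>

lemma equivariant_bilinear_factors:
  assumes G: "group G" and M: "is_rep G M" and N: "is_rep G N" and P: "is_rep G P"
    and b: "bilinear_map M N P b"
    and equi: "\<And>g v w. g \<in> carrier G \<Longrightarrow> v \<in> carrier M \<Longrightarrow> w \<in> carrier N \<Longrightarrow>
      b (act M g v) (act N g w) = act P g (b v w)"
  obtains h where "h \<in> Hom_G G (tensor_rep M N) P"
    and "\<And>v w. v \<in> carrier M \<Longrightarrow> w \<in> carrier N \<Longrightarrow> h (pure_tensor M N v w) = b v w"
proof -
  let ?T = "tensor_rep M N"
  have vP: "is_vect P" using P by (simp add: is_rep_def)
  obtain h where h: "linear_map ?T P h" "\<And>t. t \<notin> carrier ?T \<Longrightarrow> h t = 0"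
    "\<And>v w. v \<in> carrier M \<Longrightarrow> w \<in> carrier N \<Longrightarrow> h (pure_tensor M N v w) = b v w"
    using tensor_universal[OF vP b] by blast
  have "h (act ?T g t) = act P g (h t)" if g: "g \<in> carrier G" and t: "t \<in> carrier ?T" for g t
  proof (rule linear_map_tensor_eqI[OF _ _ _ t])
    show "linear_map ?T P (\<lambda>t. h (act ?T g t))"
      using linear_map_comp[OF linear_map_tensor_act[OF G M N g] h(1)] .
    have "linear_map P P (act P g)" using P g by (simp add: is_rep_def)
    then show "linear_map ?T P (\<lambda>t. act P g (h t))" using linear_map_comp[OF h(1)] by blast
    fix v w assume vw: "v \<in> carrier M" "w \<in> carrier N"
    moreover have "act M g v \<in> carrier M" "act N g w \<in> carrier N"
      using M N g vw by (auto simp: is_rep_def linear_map_def)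
    ultimately show "h (act ?T g (pure_tensor M N v w)) = act P g (h (pure_tensor M N v w))"
      by (simp add: act_pure_tensor[OF G M N g] h(3) equi[OF g])
  qed
  then have "h \<in> Hom_G G ?T P" using h by (simp add: Hom_G_def G_morphism_def)
  then show ?thesis using h(3) that by blast
qed

lemma Hom_G_tensor_eqI:
  assumes "f \<in> Hom_G G (tensor_rep M N) P" "h \<in> Hom_G G (tensor_rep M N) P"
    and "\<And>v w. v \<in> carrier M \<Longrightarrow> w \<in> carrier N \<Longrightarrow> f (pure_tensor M N v w) = h (pure_tensor M N v w)"
  shows "f = h"
proof
  fix t show "f t = h t"
    using linear_map_tensor_eqI[of M N P f h t] assms
    by (cases "t \<in> carrier (tensor_rep M N)") (auto simp: Hom_G_def G_morphism_def)
qed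


section \<open>Coefficients with respect to a labeling\<close>

lemma
  assumes L: "is_labeling G L" and i: "i1 \<in> lab_set L" "i2 \<in> lab_set L" "j \<in> lab_set L"
  shows labeling_inj: "inj_on (lab_hom L i1 i2 j) {1..hom_dim G L i1 i2 j}"
    and labeling_independent: "\<not> module.dependent (scl_fun (scl (lab_rep L j)))
      (lab_hom L i1 i2 j ` {1..hom_dim G L i1 i2 j})"
    and labeling_span: "module.span (scl_fun (scl (lab_rep L j)))
      (lab_hom L i1 i2 j ` {1..hom_dim G L i1 i2 j}) = tensor_Hom G L i1 i2 j"
  using L i unfolding is_labeling_def Let_def by blast+

lemma labeling_rep:
  assumes "is_labeling G L" "i \<in> lab_set L"
  shows "is_rep G (lab_rep L i)" "is_vect (lab_rep L i)" "vector_space (scl (lab_rep L i))"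
    "fin_dim (lab_rep L i)"
  using assms by (auto simp: is_labeling_def is_irreducible_def is_rep_def is_vect_def)

lemma lab_hom_in_tensor_Hom:
  assumes L: "is_labeling G L" and i: "i1 \<in> lab_set L" "i2 \<in> lab_set L" "j \<in> lab_set L"
    and q: "q \<in> {1..hom_dim G L i1 i2 j}"
  shows "lab_hom L i1 i2 j q \<in> tensor_Hom G L i1 i2 j"
proof -
  interpret vector_space "scl_fun (scl (lab_rep L j))"
    by (rule vector_space_scl_fun[OF labeling_rep(3)[OF L i(3)]])
  show ?thesis using span_base q unfolding labeling_span[OF L i, symmetric] by blast
qed

lemma lab_hom_closed:
  assumes L: "is_labeling G L" and i: "i1 \<in> lab_set L" "i2 \<in> lab_set L" "j \<in> lab_set L"
    and q: "q \<in> {1..hom_dim G L i1 i2 j}"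
    and vw: "v \<in> carrier (lab_rep L i1)" "w \<in> carrier (lab_rep L i2)"
  shows "lab_hom L i1 i2 j q (pure_tensor (lab_rep L i1) (lab_rep L i2) v w) \<in> carrier (lab_rep L j)"
  using lab_hom_in_tensor_Hom[OF L i q] pure_tensor_in[OF vw]
  by (auto simp: tensor_Hom_def Hom_G_def G_morphism_def linear_map_def)

text \<open>
  The value of \<open>\<Sum>q. \<alpha> q m\<^sub>q\<close> at \<open>v \<otimes> w\<close>.  It is kept as a function of the two vectors because
  the G-table is specified on pure tensors.
\<close>

definition hom_combination ::
  "('g, 'm) monoid_scheme \<Rightarrow> ('g, 'k::field, 'i, 'v::ab_group_add) labeling
    \<Rightarrow> 'i \<Rightarrow> 'i \<Rightarrow> 'i \<Rightarrow> (nat \<Rightarrow> 'k) \<Rightarrow> 'v \<Rightarrow> 'v \<Rightarrow> 'v" where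
  "hom_combination G L i1 i2 j \<alpha> v w =
    (\<Sum>q = 1..hom_dim G L i1 i2 j. scl (lab_rep L j) (\<alpha> q)
       (lab_hom L i1 i2 j q (pure_tensor (lab_rep L i1) (lab_rep L i2) v w)))"

lemma hom_combination_closed:
  assumes L: "is_labeling G L" and i: "i1 \<in> lab_set L" "i2 \<in> lab_set L" "j \<in> lab_set L"
    and vw: "v \<in> carrier (lab_rep L i1)" "w \<in> carrier (lab_rep L i2)"
  shows "hom_combination G L i1 i2 j \<alpha> v w \<in> carrier (lab_rep L j)"
  unfolding hom_combination_def
  by (intro is_vect_closed(4,3)[OF labeling_rep(2)[OF L i(3)]] lab_hom_closed[OF L i _ vw])

lemma hom_combination_cong:
  "(\<And>q. q \<in> {1..hom_dim G L i1 i2 j} \<Longrightarrow> \<alpha> q = \<beta> q) \<Longrightarrow>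
    hom_combination G L i1 i2 j \<alpha> v w = hom_combination G L i1 i2 j \<beta> v w"
  unfolding hom_combination_def by (intro sum.cong) auto

lemma hom_combination_scale:
  assumes L: "is_labeling G L" and j: "j \<in> lab_set L"
  shows "scl (lab_rep L j) a (hom_combination G L i1 i2 j \<alpha> v w) =
    hom_combination G L i1 i2 j (\<lambda>q. a * \<alpha> q) v w"
proof -
  interpret vector_space "scl (lab_rep L j)" by (rule labeling_rep(3)[OF L j])
  show ?thesis by (simp add: hom_combination_def scale_sum_right)
qed

lemma hom_combination_sum:
  assumes L: "is_labeling G L" and j: "j \<in> lab_set L"
  shows "(\<Sum>s\<in>S. hom_combination G L i1 i2 j (\<alpha> s) v w) =
    hom_combination G L i1 i2 j (\<lambda>q. \<Sum>s\<in>S. \<alpha> s q) v w"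
proof -
  interpret vector_space "scl (lab_rep L j)" by (rule labeling_rep(3)[OF L j])
  show ?thesis unfolding hom_combination_def
    by (subst sum.swap) (simp add: scale_sum_left)
qed

lemma hom_combination_zero:
  assumes L: "is_labeling G L" and j: "j \<in> lab_set L"
  shows "hom_combination G L i1 i2 j (\<lambda>_. 0) v w = 0"
proof -
  interpret vector_space "scl (lab_rep L j)" by (rule labeling_rep(3)[OF L j])
  show ?thesis by (simp add: hom_combination_def)
qed

text \<open>
  Elements of \<open>Hom\<^sub>G\<close> are linear and vanish off the carrier, so agreement on pure tensors is equality of
  functions, and linear independence of the basis applies.
\<close>

lemma hom_combination_unique:
  assumes L: "is_labeling G L" and i: "i1 \<in> lab_set L" "i2 \<in> lab_set L" "j \<in> lab_set L"
    and eq: "\<And>v w. v \<in> carrier (lab_rep L i1) \<Longrightarrow> w \<in> carrier (lab_rep L i2) \<Longrightarrow>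
      hom_combination G L i1 i2 j \<alpha> v w = hom_combination G L i1 i2 j \<beta> v w"
    and q: "q \<in> {1..hom_dim G L i1 i2 j}"
  shows "\<alpha> q = \<beta> q"
proof -
  let ?d = "hom_dim G L i1 i2 j" and ?m = "lab_hom L i1 i2 j" and ?s = "scl_fun (scl (lab_rep L j))"
  interpret j: vector_space "scl (lab_rep L j)" by (rule labeling_rep(3)[OF L i(3)])
  interpret vector_space ?s by (rule vector_space_scl_fun[OF labeling_rep(3)[OF L i(3)]])
  have Hom: "(\<Sum>q=1..?d. ?s (\<gamma> q) (?m q)) \<in> tensor_Hom G L i1 i2 j" for \<gamma>
    unfolding labeling_span[OF L i, symmetric] by (intro span_sum span_scale span_base imageI)
  have ev: "(\<Sum>q=1..?d. ?s (\<gamma> q) (?m q)) (pure_tensor (lab_rep L i1) (lab_rep L i2) v w) =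
      hom_combination G L i1 i2 j \<gamma> v w" for \<gamma> v w
    by (simp add: sum_fun_apply hom_combination_def scl_fun_def)
  have eq': "(\<Sum>q=1..?d. ?s (\<alpha> q) (?m q)) = (\<Sum>q=1..?d. ?s (\<beta> q) (?m q))"
    using Hom[of \<alpha>] Hom[of \<beta>] unfolding tensor_Hom_def
    by (rule Hom_G_tensor_eqI) (simp only: ev eq)
  \<comment> \<open>Independence is about the set of the \<open>m\<^sub>q\<close>, so the coefficients are reindexed by its elements.\<close>
  let ?u = "\<lambda>h. (\<alpha> (inv_into {1..?d} ?m h) - \<beta> (inv_into {1..?d} ?m h))"
  have inj: "inj_on ?m {1..?d}" by (rule labeling_inj[OF L i])
  have "(\<Sum>h\<in>?m ` {1..?d}. ?s (?u h) h) = (\<Sum>q=1..?d. ?s (\<alpha> q - \<beta> q) (?m q))"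
    unfolding sum.reindex[OF inj] comp_def by (intro sum.cong) (simp_all only: inv_into_f_f[OF inj])
  also have "\<dots> = 0" using eq' by (simp add: scale_left_diff_distrib sum_subtractf)
  finally have "?u (?m q) = 0"
    using q by (intro independentD[OF labeling_independent[OF L i], of "?m ` {1..?d}"]) auto
  then show ?thesis using inv_into_f_f[OF inj q] by simp
qed

lemma tensor_Hom_expand:
  assumes L: "is_labeling G L" and i: "i1 \<in> lab_set L" "i2 \<in> lab_set L" "j \<in> lab_set L"
    and h: "h \<in> tensor_Hom G L i1 i2 j"
  obtains \<alpha> where "\<And>v w. h (pure_tensor (lab_rep L i1) (lab_rep L i2) v w) = hom_combination G L i1 i2 j \<alpha> v w"
proof -
  let ?d = "hom_dim G L i1 i2 j" and ?m = "lab_hom L i1 i2 j" and ?s = "scl_fun (scl (lab_rep L j))"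
  interpret vector_space ?s by (rule vector_space_scl_fun[OF labeling_rep(3)[OF L i(3)]])
  have "h \<in> span (?m ` {1..?d})" using h by (simp only: labeling_span[OF L i])
  then obtain u where "h = (\<Sum>y\<in>?m ` {1..?d}. ?s (u y) y)" by (auto simp: span_finite)
  also have "\<dots> = (\<Sum>q=1..?d. ?s (u (?m q)) (?m q))"
    by (simp only: sum.reindex[OF labeling_inj[OF L i]] comp_def)
  finally show ?thesis
    by (intro that[of "\<lambda>q. u (?m q)"]) (simp add: sum_fun_apply hom_combination_def scl_fun_def)
qed

section \<open>The G-table\<close>

locale decomposed_algebra =
  fixes G :: "('g, 'm) monoid_scheme"
    and L :: "('g, 'k::field, 'i, 'v::ab_group_add) labeling"
    and A :: "('g, 'k, 'a::ab_group_add) rep" and \<mu> :: "'a \<Rightarrow> 'a \<Rightarrow> 'a"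
    and D :: "('i, 'v, 'r, 'a) decomposition"
  assumes group: "group G" and labeling: "is_labeling G L"
    and algebra: "G_algebra G A \<mu>" and decomposition: "is_decomposition G L A D"
begin

abbreviation V :: "'r \<Rightarrow> ('g, 'k, 'v) rep" where
  "V r \<equiv> lab_rep L (label D r)"

lemma rep: "is_rep G A" and mult_bilinear: "bilinear_map A A A \<mu>"
  using algebra by (auto simp: G_algebra_def)

sublocale internal_direct_sum A "ind D" "summand D"
  using rep decomposition by unfold_locales (auto simp: is_rep_def is_decomposition_def)

lemma label_in: "r \<in> ind D \<Longrightarrow> label D r \<in> lab_set L"
  and tau_iso: "r \<in> ind D \<Longrightarrow> G_isomorphism G (V r) (sub_rep A (summand D r)) (tau D r)"
  and summand_act: "r \<in> ind D \<Longrightarrow> g \<in> carrier G \<Longrightarrow> a \<in> summand D r \<Longrightarrow> act A g a \<in> summand D r"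
  using decomposition by (auto simp: is_decomposition_def is_submodule_def)

lemma tau_linear: "r \<in> ind D \<Longrightarrow> linear_map (V r) A (tau D r)"
  using tau_iso[of r] summand_subset[of r]
  by (auto simp: G_isomorphism_def G_morphism_def linear_map_def sub_rep_def)

lemma tau_in: "r \<in> ind D \<Longrightarrow> v \<in> carrier (V r) \<Longrightarrow> tau D r v \<in> summand D r"
  and tau_act: "r \<in> ind D \<Longrightarrow> g \<in> carrier G \<Longrightarrow> v \<in> carrier (V r) \<Longrightarrow>
    tau D r (act (V r) g v) = act A g (tau D r v)"
  and tau_bij: "r \<in> ind D \<Longrightarrow> bij_betw (tau D r) (carrier (V r)) (summand D r)"
  using tau_iso[of r] by (auto simp: G_isomorphism_def G_morphism_def linear_map_def sub_rep_def)

lemma tau_carrier: "r \<in> ind D \<Longrightarrow> v \<in> carrier (V r) \<Longrightarrow> tau D r v \<in> carrier A"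
  using tau_in summand_subset by blast

lemma tau_inv_in: "r \<in> ind D \<Longrightarrow> a \<in> summand D r \<Longrightarrow> tau_inv L D r a \<in> carrier (V r)"
  unfolding tau_inv_def by (metis tau_bij bij_betw_imp_surj_on inv_into_into)

lemma tau_tau_inv: "r \<in> ind D \<Longrightarrow> a \<in> summand D r \<Longrightarrow> tau D r (tau_inv L D r a) = a"
  unfolding tau_inv_def by (metis tau_bij bij_betw_inv_into_right)

lemma tau_inv_tau: "r \<in> ind D \<Longrightarrow> v \<in> carrier (V r) \<Longrightarrow> tau_inv L D r (tau D r v) = v"
  unfolding tau_inv_def by (metis tau_bij bij_betw_inv_into_left)

lemma rep_V: "r \<in> ind D \<Longrightarrow> is_rep G (V r)" and vect_V: "r \<in> ind D \<Longrightarrow> is_vect (V r)"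
  using labeling_rep[OF labeling label_in] by auto

lemma tau_inv_linear:
  assumes r: "r \<in> ind D"
  shows "linear_map (A\<lparr>carrier := summand D r\<rparr>) (V r) (tau_inv L D r)"
proof -
  have "tau_inv L D r (a + b) = tau_inv L D r a + tau_inv L D r b"
    if "a \<in> summand D r" "b \<in> summand D r" for a b
  proof -
    have "tau D r (tau_inv L D r a + tau_inv L D r b) = a + b"
      using that r by (simp add: linear_mapD(2)[OF tau_linear] tau_inv_in tau_tau_inv)
    then show ?thesis
      using tau_inv_tau[OF r is_vect_closed(2)[OF vect_V[OF r] tau_inv_in tau_inv_in]] that r
      by metis
  qed
  moreover have "tau_inv L D r (scl A c a) = scl (V r) c (tau_inv L D r a)"
    if "a \<in> summand D r" for a c
  proof -
    have "tau D r (scl (V r) c (tau_inv L D r a)) = scl A c a"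
      using that r by (simp add: linear_mapD(3)[OF tau_linear] tau_inv_in tau_tau_inv)
    then show ?thesis
      using tau_inv_tau[OF r is_vect_closed(3)[OF vect_V[OF r] tau_inv_in]] that r by metis
  qed
  ultimately show ?thesis using r by (simp add: linear_map_def tau_inv_in)
qed

lemma tau_inv_act:
  assumes r: "r \<in> ind D" and g: "g \<in> carrier G" and a: "a \<in> summand D r"
  shows "tau_inv L D r (act A g a) = act (V r) g (tau_inv L D r a)"
proof -
  have "act (V r) g (tau_inv L D r a) \<in> carrier (V r)"
    using rep_V[OF r] g tau_inv_in[OF r a] by (auto simp: is_rep_def linear_map_def)
  then show ?thesis using tau_act[OF r g tau_inv_in[OF r a]] tau_tau_inv[OF r a] tau_inv_tau[OF r]
    by metis
qed

lemma component_act: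
  assumes "g \<in> carrier G" "a \<in> carrier A"
  shows "component (act A g a) s = act A g (component a s)"
  using assms rep by (intro component_equivariant) (auto simp: is_rep_def summand_act)

lemma mult_act:
  assumes "g \<in> carrier G" "a \<in> carrier A" "b \<in> carrier A"
  shows "act A g (\<mu> a b) = \<mu> (act A g a) (act A g b)"
  using algebra assms by (auto simp: G_algebra_def algebra_hom_def)

definition mult_block :: "'r \<Rightarrow> 'r \<Rightarrow> 'r \<Rightarrow> 'v \<Rightarrow> 'v \<Rightarrow> 'v" where
  "mult_block r1 r2 s v w = tau_inv L D s (component (\<mu> (tau D r1 v) (tau D r2 w)) s)"

lemma mult_tau_closed:
  "r1 \<in> ind D \<Longrightarrow> r2 \<in> ind D \<Longrightarrow> v \<in> carrier (V r1) \<Longrightarrow> w \<in> carrier (V r2) \<Longrightarrow>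
    \<mu> (tau D r1 v) (tau D r2 w) \<in> carrier A"
  by (intro bilinear_map_closed[OF mult_bilinear] tau_carrier)

lemma tau_mult_block:
  assumes "r1 \<in> ind D" "r2 \<in> ind D" "s \<in> ind D" "v \<in> carrier (V r1)" "w \<in> carrier (V r2)"
  shows "tau D s (mult_block r1 r2 s v w) = component (\<mu> (tau D r1 v) (tau D r2 w)) s"
  using assms by (simp add: mult_block_def tau_tau_inv component_in mult_tau_closed)

lemma mult_block_bilinear:
  assumes r: "r1 \<in> ind D" "r2 \<in> ind D" "s \<in> ind D"
  shows "bilinear_map (V r1) (V r2) (V s) (mult_block r1 r2 s)"
proof -
  have p: "linear_map A (V s) (\<lambda>a. tau_inv L D s (component a s))"
    by (rule linear_map_comp[OF linear_component tau_inv_linear]) (use r in auto)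
  have "linear_map (V r2) (V s) (mult_block r1 r2 s v)" if "v \<in> carrier (V r1)" for v
    unfolding mult_block_def
    using linear_map_comp[OF linear_map_comp[OF tau_linear[OF r(2)]
          bilinear_mapD(1)[OF mult_bilinear tau_carrier[OF r(1) that]]] p] .
  moreover have "linear_map (V r1) (V s) (\<lambda>v. mult_block r1 r2 s v w)" if "w \<in> carrier (V r2)" for w
    unfolding mult_block_def
    using linear_map_comp[OF linear_map_comp[OF tau_linear[OF r(1)]
          bilinear_mapD(2)[OF mult_bilinear tau_carrier[OF r(2) that]]] p] .
  ultimately show ?thesis by (simp add: bilinear_map_def)
qed

text \<open>
  \<open>G\<close> acts by algebra automorphisms, and \<open>\<tau>\<close>, its inverse and the projections are equivariant, so the block
  is an equivariant bilinear map and comes from an element of \<open>Hom\<^sub>G\<close>.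
\<close>

lemma mult_block_expand:
  assumes r: "r1 \<in> ind D" "r2 \<in> ind D" "s \<in> ind D"
  obtains \<alpha> where "\<And>v w. v \<in> carrier (V r1) \<Longrightarrow> w \<in> carrier (V r2) \<Longrightarrow>
    mult_block r1 r2 s v w = hom_combination G L (label D r1) (label D r2) (label D s) \<alpha> v w"
proof -
  obtain h where h: "h \<in> Hom_G G (tensor_rep (V r1) (V r2)) (V s)"
    "\<And>v w. v \<in> carrier (V r1) \<Longrightarrow> w \<in> carrier (V r2) \<Longrightarrow>
      h (pure_tensor (V r1) (V r2) v w) = mult_block r1 r2 s v w"
  proof (rule equivariant_bilinear_factors[OF group rep_V rep_V rep_V mult_block_bilinear])
    fix g v w assume g: "g \<in> carrier G" and vw: "v \<in> carrier (V r1)" "w \<in> carrier (V r2)"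
    show "mult_block r1 r2 s (act (V r1) g v) (act (V r2) g w) = act (V s) g (mult_block r1 r2 s v w)"
      using g vw r
      by (simp add: mult_block_def tau_act mult_act[symmetric] tau_carrier component_act
          mult_tau_closed tau_inv_act component_in)
  qed (use r in auto)
  obtain \<alpha> where "\<And>v w. h (pure_tensor (V r1) (V r2) v w) =
      hom_combination G L (label D r1) (label D r2) (label D s) \<alpha> v w"
    using tensor_Hom_expand[OF labeling label_in[OF r(1)] label_in[OF r(2)] label_in[OF r(3)]]
      h(1) unfolding tensor_Hom_def by blast
  then show ?thesis using h(2) that by metis
qed

abbreviation table_block :: "('r \<Rightarrow> 'r \<Rightarrow> 'r \<Rightarrow> nat \<Rightarrow> 'k) \<Rightarrow> 'r \<Rightarrow> 'r \<Rightarrow> 'r \<Rightarrow> 'v \<Rightarrow> 'v \<Rightarrow> 'v" where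
  "table_block c r1 r2 s \<equiv>
    hom_combination G L (label D r1) (label D r2) (label D s) (c r1 r2 s)"

lemma table_block_closed:
  "r1 \<in> ind D \<Longrightarrow> r2 \<in> ind D \<Longrightarrow> s \<in> ind D \<Longrightarrow> v \<in> carrier (V r1) \<Longrightarrow> w \<in> carrier (V r2) \<Longrightarrow>
    table_block c r1 r2 s v w \<in> carrier (V s)"
  by (intro hom_combination_closed[OF labeling] label_in)

lemma tau_table_block:
  assumes r: "r1 \<in> ind D" "r2 \<in> ind D" "s \<in> ind D" and vw: "v \<in> carrier (V r1)" "w \<in> carrier (V r2)"
  shows "tau D s (table_block c r1 r2 s v w) = (\<Sum>q = 1..hom_dim3 G L D r1 r2 s.
     scl A (c r1 r2 s q) (tau D s (lab_hom L (label D r1) (label D r2) (label D s) q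
       (pure_tensor (V r1) (V r2) v w))))"
proof -
  note cl = lab_hom_closed[OF labeling label_in[OF r(1)] label_in[OF r(2)] label_in[OF r(3)] _ vw]
  show ?thesis unfolding hom_combination_def
    by (subst linear_map_sum[OF vect_V[OF r(3)] tau_linear[OF r(3)]])
      (use cl is_vect_closed(3)[OF vect_V[OF r(3)]] linear_mapD(3)[OF tau_linear[OF r(3)]] in auto)
qed

text \<open>
  Together with its converse \<open>block_imp_table\<close>, this trades the single expansion of \<open>\<mu> a b\<close> over all \<open>s\<close>
  for independent equations, one for each \<open>s\<close>, to which uniqueness of coefficients applies.
\<close>

lemma table_imp_block:
  assumes c: "is_G_table G L A \<mu> D c"
    and r: "r1 \<in> ind D" "r2 \<in> ind D" "s \<in> ind D" and vw: "v \<in> carrier (V r1)" "w \<in> carrier (V r2)"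
  shows "mult_block r1 r2 s v w = table_block c r1 r2 s v w"
proof -
  let ?F = "{s. s \<in> ind D \<and> (\<exists>q. c r1 r2 s q \<noteq> 0)}"
  have out: "\<not> (r1 \<in> ind D \<and> r2 \<in> ind D \<and> s \<in> ind D \<and> q \<in> {1..hom_dim3 G L D r1 r2 s}) \<Longrightarrow>
        c r1 r2 s q = 0" for r1 r2 s q
    using c unfolding is_G_table_def by blast
  have "finite {s. \<exists>q. c r1 r2 s q \<noteq> 0}" using c r unfolding is_G_table_def by blast
  then have fin: "finite ?F" by (rule rev_finite_subset) auto
  have "\<mu> (tau D r1 v) (tau D r2 w) = (\<Sum>s\<in>?F. tau D s (table_block c r1 r2 s v w))"
    using c r tau_in[OF r(1) vw(1)] tau_in[OF r(2) vw(2)] unfolding is_G_table_def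
    by (auto simp: tau_inv_tau vw tau_table_block[OF r(1,2) _ vw] intro!: sum.cong)
  then have "component (\<mu> (tau D r1 v) (tau D r2 w)) s =
      (if s \<in> ?F then tau D s (table_block c r1 r2 s v w) else 0)"
    by (simp only:) (intro component_of_sum[OF fin], use r vw tau_in table_block_closed in auto)
  also have "\<dots> = tau D s (table_block c r1 r2 s v w)"
  \<comment> \<open>Outside the support of the table the block of the table vanishes, so no case distinction remains.\<close>
  proof (cases "s \<in> ?F")
    case False
    then have "c r1 r2 s = (\<lambda>_. 0)" using r(3) by auto
    then show ?thesis using False r
      by (simp add: hom_combination_zero[OF labeling label_in] linear_map_zero[OF vect_V tau_linear])
  qed simp
  finally show ?thesis using r vw by (simp add: mult_block_def tau_inv_tau table_block_closed)
qed

text \<open>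
  The \<open>V\<^sub>i\<close> are finite dimensional, so the products of two summands are spanned by finitely many vectors,
  each with finitely many components.
\<close>

lemma finite_mult_support:
  assumes r: "r1 \<in> ind D" "r2 \<in> ind D"
  shows "finite {s \<in> ind D. \<exists>v\<in>carrier (V r1). \<exists>w\<in>carrier (V r2). mult_block r1 r2 s v w \<noteq> 0}"
proof -
  obtain S T where S: "finite S" "module.span (scl (V r1)) S = carrier (V r1)"
    and T: "finite T" "module.span (scl (V r2)) T = carrier (V r2)"
    using labeling_rep(4)[OF labeling label_in] r unfolding fin_dim_def by metis
  interpret V1: vector_space "scl (V r1)" by (rule labeling_rep(3)[OF labeling label_in[OF r(1)]])
  interpret V2: vector_space "scl (V r2)" by (rule labeling_rep(3)[OF labeling label_in[OF r(2)]])
  have in_car: "v \<in> carrier (V r1)" "w \<in> carrier (V r2)" if "v \<in> S" "w \<in> T" for v w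
    using S(2) T(2) that V1.span_base V2.span_base by blast+
  let ?F = "\<Union>v\<in>S. \<Union>w\<in>T. {s. component (\<mu> (tau D r1 v) (tau D r2 w)) s \<noteq> 0}"
  have "finite ?F"
    using S(1) T(1) finite_component[OF mult_tau_closed[OF r]] in_car by blast
  moreover have "mult_block r1 r2 s v w = 0"
    if s: "s \<in> ind D" "s \<notin> ?F" and vw: "v \<in> carrier (V r1)" "w \<in> carrier (V r2)" for s v w
  proof (rule bilinear_map_eq_on_span[OF V1.vector_space_axioms V2.vector_space_axioms
        S(2)[symmetric] T(2)[symmetric] mult_block_bilinear[OF r s(1)] _ _ vw])
    show "bilinear_map (V r1) (V r2) (V s) (\<lambda>_ _. 0)"
      unfolding bilinear_map_def using linear_map_zero_map[OF vect_V[OF s(1)]] by blast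
    fix v w assume "v \<in> S" "w \<in> T"
    moreover have "tau_inv L D s 0 = 0"
      using tau_inv_tau[OF s(1), of 0] is_vect_closed(1)[OF vect_V[OF s(1)]]
        linear_map_zero[OF vect_V[OF s(1)] tau_linear[OF s(1)]] by simp
    ultimately show "mult_block r1 r2 s v w = 0" using s(2) by (auto simp: mult_block_def)
  qed
  ultimately show ?thesis by (elim rev_finite_subset) blast
qed

text \<open>
  A nonzero coefficient forces a nonzero block, since coefficients are unique; this is how the finiteness of
  the support of the product turns into the finiteness demanded of a table.
\<close>

lemma block_imp_table:
  assumes out: "\<And>r1 r2 s q. \<not> (r1 \<in> ind D \<and> r2 \<in> ind D \<and> s \<in> ind D \<and> q \<in> {1..hom_dim3 G L D r1 r2 s}) \<Longrightarrow>
        c r1 r2 s q = 0"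
    and block: "\<And>r1 r2 s v w. r1 \<in> ind D \<Longrightarrow> r2 \<in> ind D \<Longrightarrow> s \<in> ind D \<Longrightarrow>
      v \<in> carrier (V r1) \<Longrightarrow> w \<in> carrier (V r2) \<Longrightarrow>
      mult_block r1 r2 s v w = table_block c r1 r2 s v w"
  shows "is_G_table G L A \<mu> D c"
proof -
  have "finite {s. \<exists>q. c r1 r2 s q \<noteq> 0} \<and>
      \<mu> a b = (\<Sum>s | s \<in> ind D \<and> (\<exists>q. c r1 r2 s q \<noteq> 0). \<Sum>q = 1..hom_dim3 G L D r1 r2 s.
              scl A (c r1 r2 s q)
                (tau D s (lab_hom L (label D r1) (label D r2) (label D s) q
                   (pure_tensor (V r1) (V r2) (tau_inv L D r1 a) (tau_inv L D r2 b)))))"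
    if r: "r1 \<in> ind D" "r2 \<in> ind D" and ab: "a \<in> summand D r1" "b \<in> summand D r2" for r1 r2 a b
  proof
    let ?F = "{s. s \<in> ind D \<and> (\<exists>q. c r1 r2 s q \<noteq> 0)}"
    have "\<exists>v\<in>carrier (V r1). \<exists>w\<in>carrier (V r2). mult_block r1 r2 s v w \<noteq> 0" if "c r1 r2 s q \<noteq> 0" for s q
    proof (rule ccontr)
      have s: "s \<in> ind D" and q: "q \<in> {1..hom_dim3 G L D r1 r2 s}" using out that by blast+
      assume "\<not> ?thesis"
      then have "c r1 r2 s q = (\<lambda>_. 0) q"
        using block[OF r s] q
        by (intro hom_combination_unique[OF labeling label_in[OF r(1)] label_in[OF r(2)] label_in[OF s]])
          (auto simp: hom_combination_zero[OF labeling label_in[OF s]])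
      with that show False by simp
    qed
    then show fin: "finite {s. \<exists>q. c r1 r2 s q \<noteq> 0}"
      using out by (intro finite_subset[OF _ finite_mult_support[OF r]]) blast
    let ?v = "tau_inv L D r1 a" and ?w = "tau_inv L D r2 b"
    have vw: "?v \<in> carrier (V r1)" "?w \<in> carrier (V r2)" using r ab by (auto intro: tau_inv_in)
    have ab_eq: "tau D r1 ?v = a" "tau D r2 ?w = b" using r ab by (auto intro: tau_tau_inv)
    have \<mu>: "\<mu> a b \<in> carrier A" using mult_tau_closed[OF r vw] by (simp add: ab_eq)
    have comp: "component (\<mu> a b) s = tau D s (table_block c r1 r2 s ?v ?w)" if "s \<in> ind D" for s
      using tau_mult_block[OF r that vw] block[OF r that vw] by (simp add: ab_eq)
    have F: "finite ?F" using fin by (rule rev_finite_subset) auto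
    have "{s. component (\<mu> a b) s \<noteq> 0} \<subseteq> ?F"
    proof clarify
      fix s assume nz: "component (\<mu> a b) s \<noteq> 0"
      then have s: "s \<in> ind D" using component_out[OF \<mu>] by blast
      have "\<exists>q. c r1 r2 s q \<noteq> 0"
      proof (rule ccontr)
        assume "\<not> ?thesis"
        then have "c r1 r2 s = (\<lambda>_. 0)" by auto
        then show False using nz s comp[OF s]
          by (simp add: hom_combination_zero[OF labeling label_in] linear_map_zero[OF vect_V tau_linear])
      qed
      with s show "s \<in> ind D \<and> (\<exists>q. c r1 r2 s q \<noteq> 0)" by blast
    qed
    from component_expand[OF \<mu> F this]
    show "\<mu> a b = (\<Sum>s\<in>?F. \<Sum>q = 1..hom_dim3 G L D r1 r2 s.
              scl A (c r1 r2 s q)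
                (tau D s (lab_hom L (label D r1) (label D r2) (label D s) q
                   (pure_tensor (V r1) (V r2) ?v ?w))))"
      by (simp add: comp tau_table_block[OF r _ vw])
  qed
  \<comment> \<open>The summands are inhabited, which detaches the finiteness statement from \<open>a\<close> and \<open>b\<close>.\<close>
  moreover have "0 \<in> summand D r" if "r \<in> ind D" for r using summand_subspace[OF that] by (rule subspace_0)
  ultimately show ?thesis unfolding is_G_table_def using out by blast
qed

lemma ex1_G_table: "\<exists>!c. is_G_table G L A \<mu> D c"
proof -
  let ?in = "\<lambda>r1 r2 s q. r1 \<in> ind D \<and> r2 \<in> ind D \<and> s \<in> ind D \<and> q \<in> {1..hom_dim3 G L D r1 r2 s}"
  let ?coeff = "\<lambda>r1 r2 s \<alpha>. \<forall>v\<in>carrier (V r1). \<forall>w\<in>carrier (V r2).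
    mult_block r1 r2 s v w = hom_combination G L (label D r1) (label D r2) (label D s) \<alpha> v w"
  define \<alpha> where "\<alpha> = (\<lambda>r1 r2 s. SOME \<alpha>. ?coeff r1 r2 s \<alpha>)"
  have \<alpha>: "?coeff r1 r2 s (\<alpha> r1 r2 s)" if "r1 \<in> ind D" "r2 \<in> ind D" "s \<in> ind D" for r1 r2 s
  proof -
    have "\<exists>\<alpha>. ?coeff r1 r2 s \<alpha>" using mult_block_expand[OF that] by metis
    then show ?thesis unfolding \<alpha>_def by (rule someI_ex)
  qed
  have "is_G_table G L A \<mu> D (\<lambda>r1 r2 s q. if ?in r1 r2 s q then \<alpha> r1 r2 s q else 0)"
    by (rule block_imp_table) (auto simp: \<alpha> intro!: hom_combination_cong)
  moreover have "c = c'" if c: "is_G_table G L A \<mu> D c" and c': "is_G_table G L A \<mu> D c'" for c c'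
  proof (intro ext)
    fix r1 r2 s q
    show "c r1 r2 s q = c' r1 r2 s q"
    proof (cases "?in r1 r2 s q")
      case True
      then show ?thesis using table_imp_block[OF c] table_imp_block[OF c']
        by (intro hom_combination_unique[OF labeling label_in[of r1] label_in[of r2] label_in[of s]]) auto
    next
      case False
      have "c r1 r2 s q = 0" using c False unfolding is_G_table_def by blast
      moreover have "c' r1 r2 s q = 0" using c' False unfolding is_G_table_def by blast
      ultimately show ?thesis by simp
    qed
  qed
  ultimately show ?thesis by blast
qed

abbreviation table :: "'r \<Rightarrow> 'r \<Rightarrow> 'r \<Rightarrow> nat \<Rightarrow> 'k" where
  "table \<equiv> G_table G L A \<mu> D"

lemma is_G_table: "is_G_table G L A \<mu> D table"
  unfolding G_table_def by (rule theI'[OF ex1_G_table])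

lemma table_out:
  "\<not> (r1 \<in> ind D \<and> r2 \<in> ind D \<and> s \<in> ind D \<and> q \<in> {1..hom_dim3 G L D r1 r2 s}) \<Longrightarrow> table r1 r2 s q = 0"
  using is_G_table unfolding is_G_table_def by blast

lemma finite_table: "r1 \<in> ind D \<Longrightarrow> r2 \<in> ind D \<Longrightarrow> finite {s. \<exists>q. table r1 r2 s q \<noteq> 0}"
  using is_G_table unfolding is_G_table_def by blast

lemma component_mult:
  assumes "r1 \<in> ind D" "r2 \<in> ind D" "s \<in> ind D" "v \<in> carrier (V r1)" "w \<in> carrier (V r2)"
  shows "component (\<mu> (tau D r1 v) (tau D r2 w)) s = tau D s (table_block table r1 r2 s v w)"
  using tau_mult_block[OF assms] table_imp_block[OF is_G_table assms] by simp

end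

section \<open>The space P(A)\<close>

lemma lookup_scl_pm: "Poly_Mapping.lookup (scl_pm a p) k = a * Poly_Mapping.lookup p k"
  by (simp add: scl_pm_def Poly_Mapping.map.rep_eq when_def)

lemma lookup_P_basis: "Poly_Mapping.lookup (P_basis r) k = (1 when r = k)"
  by (simp add: P_basis_def lookup_single)

lemma lookup_sum_P_basis:
  assumes "finite F"
  shows "Poly_Mapping.lookup (\<Sum>r\<in>F. scl_pm (h r) (P_basis r)) k = (if k \<in> F then h k else 0)"
proof -
  have "Poly_Mapping.lookup (\<Sum>r\<in>F. scl_pm (h r) (P_basis r)) k = (\<Sum>r\<in>F. if r = k then h r else 0)"
    unfolding lookup_sum lookup_scl_pm lookup_P_basis by (intro sum.cong) auto
  then show ?thesis using assms by simp
qed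

lemma vector_space_scl_pm: "vector_space (scl_pm :: 'k::field \<Rightarrow> ('r \<Rightarrow>\<^sub>0 'k) \<Rightarrow> _)"
  by unfold_locales (auto intro!: poly_mapping_eqI simp: lookup_scl_pm lookup_add algebra_simps)

lemma P_space_simps: "carrier (P_space D) = {p. Poly_Mapping.keys p \<subseteq> ind D}" "scl (P_space D) = scl_pm"
  by (simp_all add: P_space_def)

lemma P_space_iff: "p \<in> carrier (P_space D) \<longleftrightarrow> (\<forall>r. r \<notin> ind D \<longrightarrow> Poly_Mapping.lookup p r = 0)"
  by (auto simp: P_space_simps in_keys_iff)

lemma P_space_eq_span: "carrier (P_space D) = module.span (scl (P_space D)) (P_basis ` ind D)"
proof
  interpret vector_space "scl (P_space D)" by (simp add: P_space_simps vector_space_scl_pm)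
  show "carrier (P_space D) \<subseteq> span (P_basis ` ind D)"
  proof
    fix p assume p: "p \<in> carrier (P_space D)"
    have "p = (\<Sum>r\<in>Poly_Mapping.keys p. scl (P_space D) (Poly_Mapping.lookup p r) (P_basis r))"
      by (rule poly_mapping_eqI)
        (simp add: lookup_sum_P_basis P_space_simps in_keys_iff)
    also have "\<dots> \<in> span (P_basis ` ind D)"
      using p by (intro span_sum span_scale span_base) (auto simp: P_space_simps)
    finally show "p \<in> span (P_basis ` ind D)" .
  qed
  have "subspace (carrier (P_space D))"
    unfolding subspace_def by (auto simp: P_space_iff P_space_simps(2) lookup_add lookup_scl_pm)
  then show "span (P_basis ` ind D) \<subseteq> carrier (P_space D)"
    by (rule span_minimal[rotated]) (auto simp: P_space_iff lookup_P_basis when_def)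
qed

lemma P_basis_in: "r \<in> ind D \<Longrightarrow> P_basis r \<in> carrier (P_space D)"
  by (auto simp: P_space_iff lookup_P_basis when_def)

text \<open>
  The coordinates of \<open>P(\<phi>)\<close> are pairings and those of the product of \<open>P(A, Q)\<close> are iterated pairings,
  which reduces their (bi)linearity to that of the pairing.
\<close>

definition pairing :: "('r \<Rightarrow>\<^sub>0 'k) \<Rightarrow> ('r \<Rightarrow> 'k) \<Rightarrow> 'k::field" where
  "pairing p h = (\<Sum>r\<in>Poly_Mapping.keys p. Poly_Mapping.lookup p r * h r)"

lemma pairing_extend:
  assumes "finite F" "Poly_Mapping.keys p \<subseteq> F"
  shows "pairing p h = (\<Sum>r\<in>F. Poly_Mapping.lookup p r * h r)"
  unfolding pairing_def using assms by (intro sum.mono_neutral_left) (auto simp: in_keys_iff)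

lemma pairing_add_left: "pairing (p + p') h = pairing p h + pairing p' h"
proof -
  let ?F = "Poly_Mapping.keys p \<union> Poly_Mapping.keys p'"
  have F: "finite ?F" by simp
  have "pairing (p + p') h = (\<Sum>r\<in>?F. Poly_Mapping.lookup (p + p') r * h r)"
    by (rule pairing_extend[OF F keys_add])
  moreover have "pairing p h = (\<Sum>r\<in>?F. Poly_Mapping.lookup p r * h r)"
    by (rule pairing_extend[OF F]) simp
  moreover have "pairing p' h = (\<Sum>r\<in>?F. Poly_Mapping.lookup p' r * h r)"
    by (rule pairing_extend[OF F]) simp
  ultimately show ?thesis by (simp only: lookup_add distrib_right sum.distrib)
qed

lemma pairing_scale_left: "pairing (scl_pm a p) h = a * pairing p h"
proof -
  have "Poly_Mapping.keys (scl_pm a p) \<subseteq> Poly_Mapping.keys p"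
    by (auto simp: in_keys_iff lookup_scl_pm)
  then have "pairing (scl_pm a p) h = (\<Sum>r\<in>Poly_Mapping.keys p. Poly_Mapping.lookup (scl_pm a p) r * h r)"
    by (rule pairing_extend[OF finite_keys])
  then show ?thesis by (simp add: pairing_def lookup_scl_pm sum_distrib_left mult.assoc)
qed

lemma pairing_add_right: "pairing p (\<lambda>r. h r + h' r) = pairing p h + pairing p h'"
  by (simp add: pairing_def distrib_left sum.distrib)

lemma pairing_scale_right: "pairing p (\<lambda>r. a * h r) = a * pairing p h"
  by (simp add: pairing_def sum_distrib_left mult.left_commute)

lemma pairing_P_basis: "pairing (P_basis s) h = h s"
  by (simp add: pairing_def P_basis_def)

lemma P_space_closed:
  "p \<in> carrier (P_space D) \<Longrightarrow> p' \<in> carrier (P_space D) \<Longrightarrow> p + p' \<in> carrier (P_space D)"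
  "p \<in> carrier (P_space D) \<Longrightarrow> scl_pm a p \<in> carrier (P_space D)"
  by (auto simp: P_space_iff lookup_add lookup_scl_pm)

context decomposed_algebra
begin

text \<open>
  The omitted terms need no separate treatment: if \<open>d = 0\<close> then no index is in range, and the table is
  normalised to \<open>0\<close> there.
\<close>

lemma lookup_P_basis_mult:
  assumes r: "r1 \<in> ind D" "r2 \<in> ind D" and Q: "is_choice G L Q"
  shows "Poly_Mapping.lookup (P_basis_mult G L A \<mu> D Q r1 r2) s =
    table r1 r2 s (Q (label D r1) (label D r2) (label D s))"
proof -
  let ?c = "\<lambda>s. table r1 r2 s (Q (label D r1) (label D r2) (label D s))"
  let ?F = "{s. s \<in> ind D \<and> 1 \<le> hom_dim3 G L D r1 r2 s \<and> ?c s \<noteq> 0}"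
  have "finite ?F" using finite_table[OF r] by (rule rev_finite_subset) auto
  then have "Poly_Mapping.lookup (P_basis_mult G L A \<mu> D Q r1 r2) s = (if s \<in> ?F then ?c s else 0)"
    unfolding P_basis_mult_def Let_def by (rule lookup_sum_P_basis)
  also have "\<dots> = ?c s"
  proof (cases "s \<in> ?F")
    case False
    have "?c s = 0"
    proof (rule ccontr)
      assume nz: "?c s \<noteq> 0"
      then have "s \<in> ind D" "Q (label D r1) (label D r2) (label D s) \<in> {1..hom_dim3 G L D r1 r2 s}"
        using table_out by blast+
      then have "s \<in> ?F" using nz by simp
      with False show False by contradiction
    qed
    with False show ?thesis by (simp only: if_False)
  qed (simp only: if_True)
  finally show ?thesis .
qed

lemma lookup_P_mult:
  assumes p: "p \<in> carrier (P_space D)" "p' \<in> carrier (P_space D)" and Q: "is_choice G L Q"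
  shows "Poly_Mapping.lookup (P_mult G L A \<mu> D Q p p') s =
    pairing p (\<lambda>r1. pairing p' (\<lambda>r2. table r1 r2 s (Q (label D r1) (label D r2) (label D s))))"
proof -
  have "Poly_Mapping.lookup (P_basis_mult G L A \<mu> D Q r1 r2) s =
      table r1 r2 s (Q (label D r1) (label D r2) (label D s))"
    if "r1 \<in> Poly_Mapping.keys p" "r2 \<in> Poly_Mapping.keys p'" for r1 r2
    using that p by (intro lookup_P_basis_mult[OF _ _ Q]) (auto simp: P_space_simps)
  then show ?thesis
    unfolding P_mult_def pairing_def lookup_sum lookup_scl_pm sum_distrib_left
    by (intro sum.cong) (auto simp: mult.assoc)
qed

lemma P_mult_bilinear:
  assumes Q: "is_choice G L Q"
  shows "bilinear_map (P_space D) (P_space D) (P_space D) (P_mult G L A \<mu> D Q)"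
proof -
  have "P_mult G L A \<mu> D Q p p' \<in> carrier (P_space D)"
    if "p \<in> carrier (P_space D)" "p' \<in> carrier (P_space D)" for p p'
    unfolding P_space_iff by (simp add: lookup_P_mult[OF that Q] table_out pairing_def)
  then show ?thesis
    unfolding bilinear_map_def linear_map_def P_space_simps(2)
    by (auto intro!: poly_mapping_eqI simp: lookup_P_mult[OF _ _ Q] P_space_closed lookup_add lookup_scl_pm
        pairing_add_left pairing_scale_left pairing_add_right pairing_scale_right)
qed

end

section \<open>Morphisms\<close>

locale decomposed_morphism =
  A: decomposed_algebra G L A \<mu> D + B: decomposed_algebra G L B \<nu> E
  for G :: "('g, 'm) monoid_scheme"
    and L :: "('g, 'k::field, 'i, 'v::ab_group_add) labeling"
    and A :: "('g, 'k, 'a::ab_group_add) rep" and \<mu> :: "'a \<Rightarrow> 'a \<Rightarrow> 'a"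
    and D :: "('i, 'v, 'r, 'a) decomposition"
    and B :: "('g, 'k, 'b::ab_group_add) rep" and \<nu> :: "'b \<Rightarrow> 'b \<Rightarrow> 'b"
    and E :: "('i, 'v, 'x, 'b) decomposition" +
  fixes \<phi> :: "'a \<Rightarrow> 'b" and f :: "'x \<Rightarrow> 'r \<Rightarrow> 'k"
  assumes linear: "linear_map A B \<phi>" and matrix: "is_G_matrix L D B E \<phi> f"
begin

abbreviation col :: "'r \<Rightarrow> 'x set" where
  "col r \<equiv> {x. f x r \<noteq> 0}"

lemma matrix_out: "\<not> (r \<in> ind D \<and> x \<in> ind E \<and> label E x = label D r) \<Longrightarrow> f x r = 0"
  using matrix unfolding is_G_matrix_def by blast

lemma finite_col: "r \<in> ind D \<Longrightarrow> finite (col r)"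
  using matrix unfolding is_G_matrix_def by blast

lemma col_in: "x \<in> col r \<Longrightarrow> x \<in> ind E \<and> label E x = label D r"
  using matrix_out[of r x] by blast

lemma morphism_tau:
  assumes r: "r \<in> ind D" and v: "v \<in> carrier (A.V r)"
  shows "\<phi> (tau D r v) = (\<Sum>x\<in>col r. scl B (f x r) (tau E x v))"
proof -
  have col: "{x. x \<in> ind E \<and> label E x = label D r \<and> f x r \<noteq> 0} = col r"
    using col_in by blast
  have "\<forall>a\<in>summand D r. \<phi> a = (\<Sum>x | x \<in> ind E \<and> label E x = label D r \<and> f x r \<noteq> 0.
      scl B (f x r) (tau E x (tau_inv L D r a)))"
    using matrix r unfolding is_G_matrix_def by blast
  from bspec[OF this A.tau_in[OF r v]] show ?thesis by (simp only: col A.tau_inv_tau[OF r v])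
qed

lemma col_tau_in:
  assumes "v \<in> carrier (A.V r)" "x \<in> col r"
  shows "tau E x v \<in> summand E x"
  using B.tau_in[of x v] col_in[OF assms(2)] assms(1) by simp

text \<open>
  On \<open>A\<^sub>r\<close> the morphism is multiplication by the scalars \<open>f y r\<close> into the summands that have the label of
  \<open>r\<close>; for any other \<open>y\<close> the scalar is \<open>0\<close> and cancels the then arbitrary value of \<open>tau E y v\<close>.
\<close>

lemma component_morphism_tau:
  assumes r: "r \<in> ind D" and v: "v \<in> carrier (A.V r)"
  shows "B.component (\<phi> (tau D r v)) y = scl B (f y r) (tau E y v)"
proof -
  have "B.component (\<phi> (tau D r v)) y = (if y \<in> col r then scl B (f y r) (tau E y v) else 0)"
    unfolding morphism_tau[OF r v]
    using col_in col_tau_in[OF v] B.summand_subspace B.subspace_scale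
    by (intro B.component_of_sum finite_col[OF r]) blast+
  then show ?thesis by auto
qed

text \<open>
  The coefficients of \<open>m\<^sub>q\<close> in the \<open>y\<close>-component of \<open>\<phi> \<circ> \<mu>\<close> and of \<open>\<nu> \<circ> (\<phi> \<times> \<phi>)\<close> on
  \<open>A\<^bsub>r1\<^esub> \<times> A\<^bsub>r2\<^esub>\<close>.
\<close>

definition morphism_mult_coeff :: "'r \<Rightarrow> 'r \<Rightarrow> 'x \<Rightarrow> nat \<Rightarrow> 'k" where
  "morphism_mult_coeff r1 r2 y q = (\<Sum>s | \<exists>q. A.table r1 r2 s q \<noteq> 0. f y s * A.table r1 r2 s q)"

definition mult_morphism_coeff :: "'r \<Rightarrow> 'r \<Rightarrow> 'x \<Rightarrow> nat \<Rightarrow> 'k" where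
  "mult_morphism_coeff r1 r2 y q = (\<Sum>x1\<in>col r1. \<Sum>x2\<in>col r2. f x1 r1 * f x2 r2 * B.table x1 x2 y q)"

text \<open>
  The product has one component for each summand \<open>s\<close> of the source, and \<open>\<phi>\<close> carries it to \<open>y\<close>
  with the scalar \<open>f y s\<close>.  Only those \<open>s\<close> with the label of \<open>y\<close> contribute, so that all terms use the same
  basis \<open>m\<^sub>q\<close> and can be collected.
\<close>

lemma component_morphism_mult:
  assumes r: "r1 \<in> ind D" "r2 \<in> ind D" and y: "y \<in> ind E"
    and vw: "v \<in> carrier (A.V r1)" "w \<in> carrier (A.V r2)"
  shows "B.component (\<phi> (\<mu> (tau D r1 v) (tau D r2 w))) y =
    tau E y (hom_combination G L (label D r1) (label D r2) (label E y) (morphism_mult_coeff r1 r2 y) v w)"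
proof -
  let ?F = "{s. \<exists>q. A.table r1 r2 s q \<noteq> 0}"
  let ?z = "\<mu> (tau D r1 v) (tau D r2 w)"
  let ?h = "hom_combination G L (label D r1) (label D r2) (label E y)"
  let ?u = "\<lambda>s. A.table_block A.table r1 r2 s v w"
  have z: "?z \<in> carrier A" using A.mult_tau_closed[OF r vw] .
  have F: "finite ?F" using A.finite_table[OF r] .
  have F_ind: "s \<in> ind D" if "s \<in> ?F" for s using that A.table_out[of r1 r2 s] by blast
  have u: "?u s \<in> carrier (A.V s)" if "s \<in> ?F" for s
    using A.table_block_closed[OF r F_ind[OF that] vw] .
  have hc: "?h \<alpha> v w \<in> carrier (B.V y)" for \<alpha>
    using hom_combination_closed[OF A.labeling A.label_in[OF r(1)] A.label_in[OF r(2)] B.label_in[OF y] vw] .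
  have supp: "{s. A.component ?z s \<noteq> 0} \<subseteq> ?F"
  proof
    fix s assume s: "s \<in> {s. A.component ?z s \<noteq> 0}"
    then have sD: "s \<in> ind D" using A.component_support_subset[OF z] by blast
    show "s \<in> ?F"
    proof (rule ccontr)
      assume "s \<notin> ?F"
      then have "A.table r1 r2 s = (\<lambda>_. 0)" by auto
      then show False using s A.component_mult[OF r sD vw]
        by (simp add: hom_combination_zero[OF A.labeling A.label_in[OF sD]]
            linear_map_zero[OF A.vect_V[OF sD] A.tau_linear[OF sD]])
    qed
  qed
  have "?z = (\<Sum>s\<in>?F. tau D s (?u s))"
    using A.component_expand[OF z F supp] F_ind by (simp add: A.component_mult[OF r _ vw])
  then have "\<phi> ?z = (\<Sum>s\<in>?F. \<phi> (tau D s (?u s)))"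
    by (simp only:) (intro linear_map_sum[OF A.vect linear] A.tau_carrier F_ind u)
  then have "B.component (\<phi> ?z) y = (\<Sum>s\<in>?F. B.component (\<phi> (tau D s (?u s))) y)"
    by (simp only:) (intro B.component_sum linear_mapD(1)[OF linear] A.tau_carrier F_ind u)
  also have "\<dots> = (\<Sum>s\<in>?F. tau E y (?h (\<lambda>q. f y s * A.table r1 r2 s q) v w))"
  proof (intro sum.cong refl)
    fix s assume s: "s \<in> ?F"
    have "B.component (\<phi> (tau D s (?u s))) y = scl B (f y s) (tau E y (?u s))"
      by (rule component_morphism_tau[OF F_ind[OF s] u[OF s]])
    also have "\<dots> = tau E y (?h (\<lambda>q. f y s * A.table r1 r2 s q) v w)"
    proof (cases "label E y = label D s")
      case True
      have "scl B (f y s) (tau E y (?u s)) = tau E y (scl (B.V y) (f y s) (?u s))"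
        using linear_mapD(3)[OF B.tau_linear[OF y]] u[OF s] True by simp
      then show ?thesis
        using hom_combination_scale[OF A.labeling B.label_in[OF y]] True by simp
    next
      case False
      then have "f y s = 0" using matrix_out by blast
      then show ?thesis
        by (simp add: hom_combination_zero[OF A.labeling B.label_in[OF y]]
            linear_map_zero[OF B.vect_V[OF y] B.tau_linear[OF y]])
    qed
    finally show "B.component (\<phi> (tau D s (?u s))) y = tau E y (?h (\<lambda>q. f y s * A.table r1 r2 s q) v w)" .
  qed
  also have "\<dots> = tau E y (\<Sum>s\<in>?F. ?h (\<lambda>q. f y s * A.table r1 r2 s q) v w)"
    by (rule linear_map_sum[OF B.vect_V[OF y] B.tau_linear[OF y] hc, symmetric])
  also have "\<dots> = tau E y (?h (morphism_mult_coeff r1 r2 y) v w)"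
    unfolding hom_combination_sum[OF A.labeling B.label_in[OF y]] morphism_mult_coeff_def ..
  finally show ?thesis .
qed

text \<open>
  Here the sum runs over the summands of the target that have the labels of \<open>r1\<close> and \<open>r2\<close>, so the G-table of
  the target refers to the same \<open>m\<^sub>q\<close> as that of the source.
\<close>

lemma component_mult_morphism:
  assumes r: "r1 \<in> ind D" "r2 \<in> ind D" and y: "y \<in> ind E"
    and vw: "v \<in> carrier (A.V r1)" "w \<in> carrier (A.V r2)"
  shows "B.component (\<nu> (\<phi> (tau D r1 v)) (\<phi> (tau D r2 w))) y =
    tau E y (hom_combination G L (label D r1) (label D r2) (label E y) (mult_morphism_coeff r1 r2 y) v w)"
proof -
  let ?h = "hom_combination G L (label D r1) (label D r2) (label E y)"
  note tl = B.tau_linear[OF y] and vy = B.vect_V[OF y]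
  have hc: "?h \<alpha> v w \<in> carrier (B.V y)" for \<alpha>
    using hom_combination_closed[OF A.labeling A.label_in[OF r(1)] A.label_in[OF r(2)] B.label_in[OF y] vw] .
  have t1: "tau E x v \<in> carrier B" if "x \<in> col r1" for x
    using col_tau_in[OF vw(1) that] col_in[OF that] B.summand_subset by blast
  have t2: "tau E x w \<in> carrier B" if "x \<in> col r2" for x
    using col_tau_in[OF vw(2) that] col_in[OF that] B.summand_subset by blast
  have tt: "\<nu> (tau E x1 v) (tau E x2 w) \<in> carrier B" if "x1 \<in> col r1" "x2 \<in> col r2" for x1 x2
    using bilinear_map_closed[OF B.mult_bilinear t1 t2] that .
  have "\<nu> (\<phi> (tau D r1 v)) (\<phi> (tau D r2 w)) =
      (\<Sum>x1\<in>col r1. \<Sum>x2\<in>col r2. scl B (f x1 r1 * f x2 r2) (\<nu> (tau E x1 v) (tau E x2 w)))"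
    unfolding morphism_tau[OF r(1) vw(1)] morphism_tau[OF r(2) vw(2)]
    by (rule bilinear_map_sum_scale[OF B.vect B.vect B.mult_bilinear B.vect t1 t2])
  also have "B.component \<dots> y =
      (\<Sum>x1\<in>col r1. \<Sum>x2\<in>col r2. scl B (f x1 r1 * f x2 r2) (B.component (\<nu> (tau E x1 v) (tau E x2 w)) y))"
  proof -
    have st: "scl B c (\<nu> (tau E x1 v) (tau E x2 w)) \<in> carrier B" if "x1 \<in> col r1" "x2 \<in> col r2" for c x1 x2
      using is_vect_closed(3)[OF B.vect tt[OF that]] .
    have "(\<Sum>x2\<in>col r2. scl B (f x1 r1 * f x2 r2) (\<nu> (tau E x1 v) (tau E x2 w))) \<in> carrier B"
      if "x1 \<in> col r1" for x1
      using st[OF that] by (rule is_vect_closed(4)[OF B.vect])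
    then show ?thesis
      by (subst B.component_sum, assumption)
        (intro sum.cong refl, subst B.component_sum, auto intro!: st sum.cong B.component_scale tt)
  qed
  also have "\<dots> = (\<Sum>x1\<in>col r1. \<Sum>x2\<in>col r2. tau E y (?h (\<lambda>q. f x1 r1 * f x2 r2 * B.table x1 x2 y q) v w))"
  proof (intro sum.cong refl)
    fix x1 x2 assume x: "x1 \<in> col r1" "x2 \<in> col r2"
    then have x': "x1 \<in> ind E" "x2 \<in> ind E" and l: "label E x1 = label D r1" "label E x2 = label D r2"
      using col_in by blast+
    have "B.component (\<nu> (tau E x1 v) (tau E x2 w)) y = tau E y (?h (B.table x1 x2 y) v w)"
      using B.component_mult[OF x' y, of v w] vw by (simp add: l)
    then have "scl B (f x1 r1 * f x2 r2) (B.component (\<nu> (tau E x1 v) (tau E x2 w)) y) =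
        tau E y (scl (B.V y) (f x1 r1 * f x2 r2) (?h (B.table x1 x2 y) v w))"
      by (simp only: linear_mapD(3)[OF tl hc])
    then show "scl B (f x1 r1 * f x2 r2) (B.component (\<nu> (tau E x1 v) (tau E x2 w)) y) =
        tau E y (?h (\<lambda>q. f x1 r1 * f x2 r2 * B.table x1 x2 y q) v w)"
      by (simp only: hom_combination_scale[OF A.labeling B.label_in[OF y]])
  qed
  also have "\<dots> = tau E y (\<Sum>x1\<in>col r1. \<Sum>x2\<in>col r2. ?h (\<lambda>q. f x1 r1 * f x2 r2 * B.table x1 x2 y q) v w)"
    by (simp only: linear_map_sum[OF vy tl] hc is_vect_closed(4)[OF vy])
  also have "\<dots> = tau E y (?h (mult_morphism_coeff r1 r2 y) v w)"
    unfolding hom_combination_sum[OF A.labeling B.label_in[OF y]] mult_morphism_coeff_def ..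
  finally show ?thesis .
qed

lemma algebra_hom_iff_coeff:
  "algebra_hom A \<mu> B \<nu> \<phi> \<longleftrightarrow>
    (\<forall>r1\<in>ind D. \<forall>r2\<in>ind D. \<forall>y\<in>ind E. \<forall>q\<in>{1..hom_dim G L (label D r1) (label D r2) (label E y)}.
      morphism_mult_coeff r1 r2 y q = mult_morphism_coeff r1 r2 y q)"
proof
  assume hom: "algebra_hom A \<mu> B \<nu> \<phi>"
  show "\<forall>r1\<in>ind D. \<forall>r2\<in>ind D. \<forall>y\<in>ind E. \<forall>q\<in>{1..hom_dim G L (label D r1) (label D r2) (label E y)}.
      morphism_mult_coeff r1 r2 y q = mult_morphism_coeff r1 r2 y q"
  proof (intro ballI)
    fix r1 r2 y q
    assume r: "r1 \<in> ind D" "r2 \<in> ind D" and y: "y \<in> ind E"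
      and q: "q \<in> {1..hom_dim G L (label D r1) (label D r2) (label E y)}"
    note l = A.label_in[OF r(1)] A.label_in[OF r(2)] B.label_in[OF y]
    show "morphism_mult_coeff r1 r2 y q = mult_morphism_coeff r1 r2 y q"
    proof (rule hom_combination_unique[OF A.labeling l _ q])
      fix v w assume vw: "v \<in> carrier (A.V r1)" "w \<in> carrier (A.V r2)"
      let ?h = "\<lambda>\<alpha>. hom_combination G L (label D r1) (label D r2) (label E y) \<alpha> v w"
      have "\<phi> (\<mu> (tau D r1 v) (tau D r2 w)) = \<nu> (\<phi> (tau D r1 v)) (\<phi> (tau D r2 w))"
        using hom A.tau_carrier r vw by (simp add: algebra_hom_def)
      then have "tau E y (?h (morphism_mult_coeff r1 r2 y)) = tau E y (?h (mult_morphism_coeff r1 r2 y))"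
        using component_morphism_mult[OF r y vw] component_mult_morphism[OF r y vw] by simp
      then show "?h (morphism_mult_coeff r1 r2 y) = ?h (mult_morphism_coeff r1 r2 y)"
        using B.tau_inv_tau[OF y hom_combination_closed[OF A.labeling l vw]] by metis
    qed
  qed
next
  assume coeff: "\<forall>r1\<in>ind D. \<forall>r2\<in>ind D. \<forall>y\<in>ind E.
      \<forall>q\<in>{1..hom_dim G L (label D r1) (label D r2) (label E y)}.
      morphism_mult_coeff r1 r2 y q = mult_morphism_coeff r1 r2 y q"
  have bil: "bilinear_map A A B (\<lambda>a b. \<phi> (\<mu> a b))" "bilinear_map A A B (\<lambda>a b. \<nu> (\<phi> a) (\<phi> b))"
    using A.mult_bilinear B.mult_bilinear linear by (auto simp: bilinear_map_def linear_map_def)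
  have "\<phi> (\<mu> a b) = \<nu> (\<phi> a) (\<phi> b)" if "a \<in> carrier A" "b \<in> carrier A" for a b
  proof (rule bilinear_map_eq_on_span[OF A.vector_space_axioms A.vector_space_axioms
        A.carrier_eq_span A.carrier_eq_span bil _ that])
    fix a b assume "a \<in> (\<Union>r\<in>ind D. summand D r)" "b \<in> (\<Union>r\<in>ind D. summand D r)"
    then obtain r1 r2 where r: "r1 \<in> ind D" "r2 \<in> ind D" and ab: "a \<in> summand D r1" "b \<in> summand D r2"
      by blast
    let ?v = "tau_inv L D r1 a" and ?w = "tau_inv L D r2 b"
    have vw: "?v \<in> carrier (A.V r1)" "?w \<in> carrier (A.V r2)" using r ab by (auto intro: A.tau_inv_in)
    have ab_eq: "tau D r1 ?v = a" "tau D r2 ?w = b" using r ab by (auto intro: A.tau_tau_inv)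
    have ab': "a \<in> carrier A" "b \<in> carrier A" using r ab A.summand_subset by blast+
    show "\<phi> (\<mu> a b) = \<nu> (\<phi> a) (\<phi> b)"
    proof (rule B.component_eqI)
      fix y assume y: "y \<in> ind E"
      have "B.component (\<phi> (\<mu> (tau D r1 ?v) (tau D r2 ?w))) y =
          B.component (\<nu> (\<phi> (tau D r1 ?v)) (\<phi> (tau D r2 ?w))) y"
        unfolding component_morphism_mult[OF r y vw] component_mult_morphism[OF r y vw]
        using coeff r y by (intro arg_cong[of _ _ "tau E y"] hom_combination_cong) blast
      then show "B.component (\<phi> (\<mu> a b)) y = B.component (\<nu> (\<phi> a) (\<phi> b)) y"
        by (simp only: ab_eq)
    qed (use bilinear_map_closed[OF bil(1) ab'] bilinear_map_closed[OF bil(2) ab'] in auto)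
  qed
  then show "algebra_hom A \<mu> B \<nu> \<phi>" using linear by (simp add: algebra_hom_def)
qed

lemma lookup_P_map:
  assumes "p \<in> carrier (P_space D)"
  shows "Poly_Mapping.lookup (P_map E f p) y = pairing p (f y)"
proof -
  have "Poly_Mapping.lookup (\<Sum>x | x \<in> ind E \<and> f x r \<noteq> 0. scl_pm (f x r) (P_basis x)) y = f y r"
    if "r \<in> ind D" for r
  proof -
    have "finite {x. x \<in> ind E \<and> f x r \<noteq> 0}" using finite_col[OF that] by (rule rev_finite_subset) auto
    then show ?thesis using matrix_out[of r y]
      by (auto simp: lookup_sum_P_basis)
  qed
  then show ?thesis using assms
    by (auto simp: P_map_def pairing_def lookup_sum lookup_scl_pm P_space_simps intro!: sum.cong)
qed

lemma P_map_linear: "linear_map (P_space D) (P_space E) (P_map E f)"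
proof -
  have "P_map E f p \<in> carrier (P_space E)" if "p \<in> carrier (P_space D)" for p
    unfolding P_space_iff using that by (simp add: lookup_P_map matrix_out pairing_def)
  then show ?thesis unfolding linear_map_def P_space_simps(2)
    by (auto intro!: poly_mapping_eqI
        simp: lookup_P_map P_space_closed lookup_add lookup_scl_pm pairing_add_left pairing_scale_left)
qed

text \<open>
  \<open>P(A, Q)\<close> selects the index \<open>q\<close> by the label of \<open>s\<close>, the coefficient in question by the label of \<open>y\<close>.
  They coincide whenever \<open>f y s\<close> is nonzero.
\<close>

lemma lookup_P_map_mult:
  assumes r: "r1 \<in> ind D" "r2 \<in> ind D" and Q: "is_choice G L Q"
  shows "Poly_Mapping.lookup (P_map E f (P_mult G L A \<mu> D Q (P_basis r1) (P_basis r2))) y =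
    morphism_mult_coeff r1 r2 y (Q (label D r1) (label D r2) (label E y))"
proof -
  let ?p = "P_mult G L A \<mu> D Q (P_basis r1) (P_basis r2)"
  let ?F = "{s. \<exists>q. A.table r1 r2 s q \<noteq> 0}"
  have p: "?p \<in> carrier (P_space D)"
    using bilinear_map_closed[OF A.P_mult_bilinear[OF Q] P_basis_in P_basis_in] r .
  have lk: "Poly_Mapping.lookup ?p s = A.table r1 r2 s (Q (label D r1) (label D r2) (label D s))" for s
    by (simp only: A.lookup_P_mult[OF P_basis_in[OF r(1)] P_basis_in[OF r(2)] Q] pairing_P_basis)
  have "Poly_Mapping.keys ?p \<subseteq> ?F" by (auto simp: in_keys_iff lk)
  then have "Poly_Mapping.lookup (P_map E f ?p) y = (\<Sum>s\<in>?F. Poly_Mapping.lookup ?p s * f y s)"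
    unfolding lookup_P_map[OF p] by (rule pairing_extend[OF A.finite_table[OF r]])
  also have "\<dots> = morphism_mult_coeff r1 r2 y (Q (label D r1) (label D r2) (label E y))"
    unfolding morphism_mult_coeff_def
  proof (intro sum.cong refl)
    fix s
    show "Poly_Mapping.lookup ?p s * f y s =
        f y s * A.table r1 r2 s (Q (label D r1) (label D r2) (label E y))"
      using matrix_out[of s y] by (cases "label E y = label D s") (auto simp: lk)
  qed
  finally show ?thesis .
qed

lemma lookup_P_mult_map:
  assumes r: "r1 \<in> ind D" "r2 \<in> ind D" and Q: "is_choice G L Q"
  shows "Poly_Mapping.lookup (P_mult G L B \<nu> E Q (P_map E f (P_basis r1)) (P_map E f (P_basis r2))) y =
    mult_morphism_coeff r1 r2 y (Q (label D r1) (label D r2) (label E y))"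
proof -
  let ?p = "\<lambda>r. P_map E f (P_basis r)"
  have p: "?p r \<in> carrier (P_space E)" if "r \<in> ind D" for r
    using linear_mapD(1)[OF P_map_linear P_basis_in[OF that]] .
  have lk: "Poly_Mapping.lookup (?p r) x = f x r" if "r \<in> ind D" for r x
    by (simp only: lookup_P_map[OF P_basis_in[OF that]] pairing_P_basis)
  have keys: "Poly_Mapping.keys (?p r) = col r" if "r \<in> ind D" for r
    by (auto simp: in_keys_iff lk[OF that])
  show ?thesis
    unfolding B.lookup_P_mult[OF p[OF r(1)] p[OF r(2)] Q] mult_morphism_coeff_def keys[OF r(1)] keys[OF r(2)]
      pairing_def sum_distrib_left
    by (intro sum.cong refl) (use col_in r in \<open>auto simp: lk mult.assoc\<close>)
qed

text \<open>
  Both sides of the multiplicativity equation are bilinear, so it can be tested on the basis vectors, where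
  their coordinates are the coefficients of \<open>\<phi> \<circ> \<mu>\<close> and \<open>\<nu> \<circ> (\<phi> \<times> \<phi>)\<close> at the selected index.
\<close>

lemma P_algebra_hom_iff_coeff:
  assumes Q: "is_choice G L Q"
  shows "algebra_hom (P_space D) (P_mult G L A \<mu> D Q) (P_space E) (P_mult G L B \<nu> E Q) (P_map E f) \<longleftrightarrow>
    (\<forall>r1\<in>ind D. \<forall>r2\<in>ind D. \<forall>y. morphism_mult_coeff r1 r2 y (Q (label D r1) (label D r2) (label E y)) =
      mult_morphism_coeff r1 r2 y (Q (label D r1) (label D r2) (label E y)))" (is "?hom \<longleftrightarrow> ?coeff")
proof
  assume ?hom
  show ?coeff
  proof (intro ballI allI)
    fix r1 r2 y assume r: "r1 \<in> ind D" "r2 \<in> ind D"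
    have "P_map E f (P_mult G L A \<mu> D Q (P_basis r1) (P_basis r2)) =
        P_mult G L B \<nu> E Q (P_map E f (P_basis r1)) (P_map E f (P_basis r2))"
      using conjunct2[OF \<open>?hom\<close>[unfolded algebra_hom_def], rule_format, OF P_basis_in P_basis_in] r .
    then show "morphism_mult_coeff r1 r2 y (Q (label D r1) (label D r2) (label E y)) =
        mult_morphism_coeff r1 r2 y (Q (label D r1) (label D r2) (label E y))"
      using lookup_P_map_mult[OF r Q, of y] lookup_P_mult_map[OF r Q, of y] by simp
  qed
next
  assume coeff: ?coeff
  let ?m = "P_mult G L A \<mu> D Q" and ?n = "P_mult G L B \<nu> E Q"
  have bil: "bilinear_map (P_space D) (P_space D) (P_space E) (\<lambda>p p'. P_map E f (?m p p'))"
    "bilinear_map (P_space D) (P_space D) (P_space E) (\<lambda>p p'. ?n (P_map E f p) (P_map E f p'))"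
    using A.P_mult_bilinear[OF Q] B.P_mult_bilinear[OF Q] P_map_linear
    by (auto simp: bilinear_map_def linear_map_def)
  have vs: "vector_space (scl (P_space D :: ('k, 'r \<Rightarrow>\<^sub>0 'k) vect))"
    by (simp add: P_space_simps vector_space_scl_pm)
  have "P_map E f (?m p p') = ?n (P_map E f p) (P_map E f p')"
    if "p \<in> carrier (P_space D)" "p' \<in> carrier (P_space D)" for p p'
  proof (rule bilinear_map_eq_on_span[OF vs vs P_space_eq_span P_space_eq_span bil _ that])
    fix p p' :: "'r \<Rightarrow>\<^sub>0 'k" assume "p \<in> P_basis ` ind D" "p' \<in> P_basis ` ind D"
    then show "P_map E f (?m p p') = ?n (P_map E f p) (P_map E f p')"
      using coeff by (auto intro!: poly_mapping_eqI simp: lookup_P_map_mult[OF _ _ Q] lookup_P_mult_map[OF _ _ Q])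
  qed
  then show ?hom using P_map_linear by (simp add: algebra_hom_def)
qed

text \<open>
  The normalisation of the G-table and the G-matrix outside their index ranges makes the comparison of
  coefficients trivial there, so that agreement within range yields it for the value of an arbitrary choice.
\<close>

lemma coeff_out:
  assumes "y \<notin> ind E"
  shows "morphism_mult_coeff r1 r2 y q = 0" "mult_morphism_coeff r1 r2 y q = 0"
  using assms by (simp_all add: morphism_mult_coeff_def mult_morphism_coeff_def matrix_out B.table_out)

lemma coeff_dim_out:
  assumes "q \<notin> {1..hom_dim G L (label D r1) (label D r2) (label E y)}"
  shows "morphism_mult_coeff r1 r2 y q = 0" "mult_morphism_coeff r1 r2 y q = 0"
proof -
  have "f y s * A.table r1 r2 s q = 0" for s
    using assms matrix_out[of s y] A.table_out[of r1 r2 s q] by (cases "label E y = label D s") auto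
  then show "morphism_mult_coeff r1 r2 y q = 0" unfolding morphism_mult_coeff_def by (intro sum.neutral ballI)
  have "B.table x1 x2 y q = 0" if "x1 \<in> col r1" "x2 \<in> col r2" for x1 x2
    using assms col_in[OF that(1)] col_in[OF that(2)] B.table_out[of x1 x2 y q] by auto
  then show "mult_morphism_coeff r1 r2 y q = 0" by (simp add: mult_morphism_coeff_def)
qed

lemma algebra_hom_iff_P:
  "algebra_hom A \<mu> B \<nu> \<phi> \<longleftrightarrow> (\<forall>Q. is_choice G L Q \<longrightarrow>
    algebra_hom (P_space D) (P_mult G L A \<mu> D Q) (P_space E) (P_mult G L B \<nu> E Q) (P_map E f))"
  (is "?hom \<longleftrightarrow> ?P")
proof
  assume ?hom
  then have eq: "morphism_mult_coeff r1 r2 y q = mult_morphism_coeff r1 r2 y q"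
    if "r1 \<in> ind D" "r2 \<in> ind D" for r1 r2 y q
    using that unfolding algebra_hom_iff_coeff by (metis coeff_out coeff_dim_out)
  show ?P using P_algebra_hom_iff_coeff eq by blast
next
  assume P: ?P
  show ?hom unfolding algebra_hom_iff_coeff
  proof (intro ballI)
    fix r1 r2 y q
    assume r: "r1 \<in> ind D" "r2 \<in> ind D" and y: "y \<in> ind E"
      and q: "q \<in> {1..hom_dim G L (label D r1) (label D r2) (label E y)}"
    define Q where "Q = (\<lambda>i1 i2 j.
      if (i1, i2, j) = (label D r1, label D r2, label E y) then q else 1)"
    \<comment> \<open>The index \<open>1\<close> is admissible at every triple at which a choice is constrained.\<close>
    have "is_choice G L Q" using q by (auto simp: is_choice_def Q_def)
    then have "morphism_mult_coeff r1 r2 y (Q (label D r1) (label D r2) (label E y)) =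
        mult_morphism_coeff r1 r2 y (Q (label D r1) (label D r2) (label E y))"
      using P P_algebra_hom_iff_coeff r by blast
    then show "morphism_mult_coeff r1 r2 y q = mult_morphism_coeff r1 r2 y q" by (simp add: Q_def)
  qed
qed

end

theorem corollary2p19:
  fixes G :: "('g, 'm) monoid_scheme"
    and L :: "('g, 'k::field_char_0, 'i, 'v::ab_group_add) labeling"
    and A :: "('g, 'k, 'a::ab_group_add) rep" and \<mu> :: "'a \<Rightarrow> 'a \<Rightarrow> 'a"
    and B :: "('g, 'k, 'b::ab_group_add) rep" and \<nu> :: "'b \<Rightarrow> 'b \<Rightarrow> 'b"
    and D :: "('i, 'v, 'r, 'a) decomposition"
    and E :: "('i, 'v, 'x, 'b) decomposition"
    and \<phi> :: "'a \<Rightarrow> 'b"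
    and f :: "'x \<Rightarrow> 'r \<Rightarrow> 'k"
  assumes "group G"
    and "fd_reps_completely_reducible G TYPE('k)"
    and "is_labeling G L"
    and "G_algebra G A \<mu>" and "is_decomposition G L A D"
    and "G_algebra G B \<nu>" and "is_decomposition G L B E"
    and "G_morphism G A B \<phi>"
    and "is_G_matrix L D B E \<phi> f"
  shows "G_algebra_morphism G A \<mu> B \<nu> \<phi> \<longleftrightarrow>
    (\<forall>Q. is_choice G L Q \<longrightarrow>
       algebra_hom (P_space D) (P_mult G L A \<mu> D Q) (P_space E) (P_mult G L B \<nu> E Q) (P_map E f))"
proof -
  interpret decomposed_morphism G L A \<mu> D B \<nu> E \<phi> f
    using assms(8)
    by (intro decomposed_morphism.intro decomposed_algebra.intro decomposed_morphism_axioms.intro assms)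
      (simp add: G_morphism_def)
  show ?thesis using algebra_hom_iff_P assms(8) by (simp add: G_algebra_morphism_def)
qed

end
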